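(* For every non-negative integer $\theta$, every graph $G$ has a tree-decomposition $T$ of adhesion less than $\theta$ and width at most $\operatorname{tw}_\theta(G)$ such that every node-bag $Y_t$ ($t\in V(T)$) is a $\theta$-connected set in $G$.
   Context: Tree-decompositions: a tree-decomposition of $G$ is a tree $T$ (whose vertices are called nodes) such that $E(G)$ is a subset of the set of leaves of $T$. For $v\in V(G)$ let $T_v$ be the minimal subtree of $T$ containing all leaves of $T$ that are edges of $G$ incident with $v$. For a node $t$ the node-bag is $Y_t=\{v\in V(G): t\in V(T_v)\}$; for an edge $e=tt'$ of $T$ the edge-bag is $Y_e=Y_t\cap Y_{t'}$. The width of $T$ is $\max_t|Y_t|-1$ and its adhesion is $\max_e|Y_e|$. $\operatorname{tw}_\theta(G)$, the $\theta$-tree-width, is the minimum width of a tree-decomposition of $G$ of adhesion less than $\theta$. A separation of $G$ is an ordered pair $(G_1,G_2)$ of subgraphs with $G=G_1\cup G_2$; its order is $\lambda(G_1,G_2)=|V(G_1)\cap V(G_2)|$. A set $U\subseteq V(G)$ is $\theta$-connected if $\min\{|U\cap V(G_1)|,|U\cap V(G_2)|\}\le\lambda(G_1,G_2)$ for every separation $(G_1,G_2)$ of $G$ of order less than $\theta$.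
   Formalization: For θ ≤ 2 the claim is made only if G has some tree-decomposition of adhesion less than θ (a triangle with θ = 2 has none, so tw_θ is undefined); for θ ≥ 3 it is unconditional. Graphs are finite; a one-node tree has adhesion 0. *)

theory Defs
  imports Main
begin

text \<open>
  Finite undirected graphs with named edges. Loops (one end) and parallel edges are allowed;
  a simple graph is the case where no edge is a loop and \<open>ends\<close> is injective on the edges.
  The symmetric digraphs of the AFP entry Graph_Theory do not fit here: an undirected edge would
  be two arcs, hence two leaves of a tree-decomposition, and its trees exclude directed
  cycles only.
\<close>

record ('v, 'e) mgraph =
  verts :: "'v set"
  edges :: "'e set"
  ends :: "'e \<Rightarrow> 'v set"

definition fin_mgraph :: "('v, 'e) mgraph \<Rightarrow> bool" where
  "fin_mgraph G \<longleftrightarrow> finite (verts G) \<and> finite (edges G) \<and>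
     (\<forall>e\<in>edges G. ends G e \<subseteq> verts G \<and> card (ends G e) \<in> {1, 2})"

text \<open>The values of \<open>ends\<close> outside the edge set carry no information and are not compared.\<close>

definition subgraph_of :: "('v, 'e) mgraph \<Rightarrow> ('v, 'e) mgraph \<Rightarrow> bool" where
  "subgraph_of H G \<longleftrightarrow> fin_mgraph H \<and> verts H \<subseteq> verts G \<and> edges H \<subseteq> edges G \<and>
     (\<forall>e\<in>edges H. ends H e = ends G e)"

definition separation ::
  "('v, 'e) mgraph \<Rightarrow> ('v, 'e) mgraph \<Rightarrow> ('v, 'e) mgraph \<Rightarrow> bool" where
  "separation G G1 G2 \<longleftrightarrow> subgraph_of G1 G \<and> subgraph_of G2 G \<and>
     verts G = verts G1 \<union> verts G2 \<and> edges G = edges G1 \<union> edges G2"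

definition sep_order :: "('v, 'e) mgraph \<Rightarrow> ('v, 'e) mgraph \<Rightarrow> nat" where
  "sep_order G1 G2 = card (verts G1 \<inter> verts G2)"

definition theta_connected :: "nat \<Rightarrow> ('v, 'e) mgraph \<Rightarrow> 'v set \<Rightarrow> bool" where
  "theta_connected \<theta> G U \<longleftrightarrow> U \<subseteq> verts G \<and>
     (\<forall>G1 G2. separation G G1 G2 \<and> sep_order G1 G2 < \<theta> \<longrightarrow>
        min (card (U \<inter> verts G1)) (card (U \<inter> verts G2)) \<le> sep_order G1 G2)"

record 'n sgraph =
  nodes :: "'n set"
  links :: "'n set set"

definition fin_sgraph :: "'n sgraph \<Rightarrow> bool" where
  "fin_sgraph T \<longleftrightarrow> finite (nodes T) \<and> (\<forall>l\<in>links T. l \<subseteq> nodes T \<and> card l = 2)"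

definition sg_path :: "'n sgraph \<Rightarrow> 'n list \<Rightarrow> bool" where
  "sg_path T p \<longleftrightarrow> p \<noteq> [] \<and> set p \<subseteq> nodes T \<and> distinct p \<and>
     successively (\<lambda>x y. {x, y} \<in> links T) p"

definition sg_connected :: "'n sgraph \<Rightarrow> bool" where
  "sg_connected T \<longleftrightarrow>
     (\<forall>s\<in>nodes T. \<forall>t\<in>nodes T. \<exists>p. sg_path T p \<and> hd p = s \<and> last p = t)"

definition sg_cycle :: "'n sgraph \<Rightarrow> 'n list \<Rightarrow> bool" where
  "sg_cycle T p \<longleftrightarrow> sg_path T p \<and> length p \<ge> 3 \<and> {last p, hd p} \<in> links T"

definition is_tree :: "'n sgraph \<Rightarrow> bool" where
  "is_tree T \<longleftrightarrow> fin_sgraph T \<and> nodes T \<noteq> {} \<and> sg_connected T \<and> \<not> (\<exists>p. sg_cycle T p)"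

definition leaves :: "'n sgraph \<Rightarrow> 'n set" where
  "leaves T = {t \<in> nodes T. card {l \<in> links T. t \<in> l} = 1}"

definition sg_subgraph :: "'n sgraph \<Rightarrow> 'n sgraph \<Rightarrow> bool" where
  "sg_subgraph S T \<longleftrightarrow> nodes S \<subseteq> nodes T \<and> links S \<subseteq> links T"

text \<open>
  The null graph counts as a subtree, so that the minimal subtree containing no leaf at all
  (which arises for isolated vertices of \<open>G\<close>) is null rather than an arbitrary single node.
\<close>

definition subtree :: "'n sgraph \<Rightarrow> 'n sgraph \<Rightarrow> bool" where
  "subtree S T \<longleftrightarrow> sg_subgraph S T \<and> (is_tree S \<or> S = \<lparr>nodes = {}, links = {}\<rparr>)"

definition minimal_subtree :: "'n sgraph \<Rightarrow> 'n set \<Rightarrow> 'n sgraph" where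
  "minimal_subtree T L = (THE S. subtree S T \<and> L \<subseteq> nodes S \<and>
     (\<forall>S'. subtree S' T \<and> L \<subseteq> nodes S' \<and> sg_subgraph S' S \<longrightarrow> S' = S))"

text \<open>
  In a tree-decomposition the edges of \<open>G\<close> are themselves nodes of the tree. The node type is
  \<^typ>\<open>'e + nat\<close>: the edge \<open>e\<close> is the node \<open>Inl e\<close>, and the \<open>Inr\<close> nodes provide an unlimited
  supply of further ones.
\<close>

definition tree_decomposition :: "('v, 'e) mgraph \<Rightarrow> ('e + nat) sgraph \<Rightarrow> bool" where
  "tree_decomposition G T \<longleftrightarrow> is_tree T \<and> Inl ` edges G \<subseteq> leaves T"

definition vertex_subtree ::
  "('v, 'e) mgraph \<Rightarrow> ('e + nat) sgraph \<Rightarrow> 'v \<Rightarrow> ('e + nat) sgraph" where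
  "vertex_subtree G T v = minimal_subtree T (Inl ` {e \<in> edges G. v \<in> ends G e})"

definition node_bag :: "('v, 'e) mgraph \<Rightarrow> ('e + nat) sgraph \<Rightarrow> 'e + nat \<Rightarrow> 'v set" where
  "node_bag G T t = {v \<in> verts G. t \<in> nodes (vertex_subtree G T v)}"

definition edge_bag :: "('v, 'e) mgraph \<Rightarrow> ('e + nat) sgraph \<Rightarrow> ('e + nat) set \<Rightarrow> 'v set" where
  "edge_bag G T l = (\<Inter>t\<in>l. node_bag G T t)"

text \<open>The width is an integer because it is \<open>-1\<close> when all bags are empty.\<close>

definition width :: "('v, 'e) mgraph \<Rightarrow> ('e + nat) sgraph \<Rightarrow> int" where
  "width G T = int (Max ((\<lambda>t. card (node_bag G T t)) ` nodes T)) - 1"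

text \<open>A one-node tree has no edges; its adhesion is \<open>0\<close>.\<close>

definition adhesion :: "('v, 'e) mgraph \<Rightarrow> ('e + nat) sgraph \<Rightarrow> nat" where
  "adhesion G T = Max (insert 0 ((\<lambda>l. card (edge_bag G T l)) ` links T))"

text \<open>
  The minimum is over a finite set (widths lie between \<open>-1\<close> and \<open>card (verts G) - 1\<close>), but the
  set is empty, and \<open>tw\<close> unspecified, when \<open>G\<close> has no tree-decomposition of adhesion less
  than \<open>\<theta>\<close>. This happens for \<open>\<theta> \<le> 2\<close> only: if both ends of an edge \<open>e\<close> meet other edges, then
  the tree edge at the leaf \<open>e\<close> has both ends of \<open>e\<close> in its bag.
\<close>

definition tw :: "nat \<Rightarrow> ('v, 'e) mgraph \<Rightarrow> int" where
  "tw \<theta> G = Min {width G T | T. tree_decomposition G T \<and> adhesion G T < \<theta>}"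

end

theory Submission
  imports Defs "HOL-Library.Multiset"
begin

text \<open>
  Rooted at a node \<open>t\<close>, a tree-decomposition is a laminar family of edge sets \<open>D s\<close> (the edges of \<open>G\<close>
  below the node \<open>s\<close>), and every bag is a union of boundaries \<open>bd (D s)\<close>, where \<open>bd F\<close> is the set of
  vertices incident both with \<open>F\<close> and with its complement.

  Suppose that the bag \<open>U\<close> of \<open>t\<close> is not \<open>\<theta>\<close>-connected, as witnessed by a separation of order \<open>k < \<theta>\<close> with
  sets \<open>Z1, Z2 \<subseteq> U\<close> of size \<open>k + 1\<close> on its two sides. Among all bipartitions \<open>(A, B)\<close> of the edges choose
  one that separates \<open>Z1\<close> from \<open>Z2\<close> by as few vertices as possible and, subject to this, by vertices that
  lie as close to \<open>t\<close> as possible. Take two copies of the tree, keep the edges of \<open>A\<close> as leaves of the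
  first and those of \<open>B\<close> as leaves of the second, and join the two copies of \<open>t\<close>. Comparing \<open>A\<close> with
  \<open>A \<union> D s\<close> (and \<open>B\<close> with \<open>B \<union> D s\<close>) shows that no adhesion set and no bag grows, that both copies of \<open>t\<close>
  get smaller bags, and that if one copy of \<open>s \<noteq> t\<close> keeps its bag size then the other one has at most
  \<open>k < |U|\<close> vertices. So the multiset of bag sizes decreases in the multiset order, and a
  minimal decomposition among those of optimal width has only \<open>\<theta>\<close>-connected bags.
\<close>

section \<open>Rooted trees\<close>

text \<open>Nodes are prepended to a path one at a time; when the new node already lies on the path,
  the path is cut down to its suffix from that node.\<close>

lemma rtrancl_imp_sg_path:
  assumes "(x, y) \<in> {(a, b). a \<in> nodes T \<and> b \<in> nodes T \<and> {a, b} \<in> links T}\<^sup>*" and "y \<in> nodes T"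
  shows "\<exists>q. sg_path T q \<and> hd q = x \<and> last q = y"
  using assms(1)
proof (induction rule: converse_rtrancl_induct)
  case base
  then show ?case using assms(2) by (intro exI[of _ "[y]"]) (simp add: sg_path_def)
next
  case (step x z)
  then obtain q where q: "sg_path T q" "hd q = z" "last q = y" by blast
  have xz: "x \<in> nodes T" "{x, z} \<in> links T" using step.hyps(1) by auto
  show ?case
  proof (cases "x \<in> set q")
    case True
    then obtain ys zs where s: "q = ys @ x # zs" by (meson split_list)
    have "sg_path T (x # zs)" using q(1) unfolding sg_path_def s
      by (auto simp: successively_append_iff)
    moreover have "last (x # zs) = y" using q(3) s by simp
    ultimately show ?thesis by (metis list.sel(1))
  next
    case False
    have "q \<noteq> []" using q(1) by (simp add: sg_path_def)
    then have "sg_path T (x # q)" using q xz False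
      by (cases q) (auto simp: sg_path_def)
    moreover have "last (x # q) = y" using q(3) \<open>q \<noteq> []\<close> by simp
    ultimately show ?thesis by (metis list.sel(1))
  qed
qed

lemma successively_crossing:
  assumes "successively R q" "q \<noteq> []" "hd q \<in> X" "last q \<notin> X"
  shows "\<exists>u w. u \<in> set q \<and> w \<in> set q \<and> u \<in> X \<and> w \<notin> X \<and> R u w"
  using assms
proof (induction q rule: induct_list012)
  case (3 x y zs)
  show ?case
  proof (cases "y \<in> X")
    case True
    then show ?thesis using 3 by auto
  next
    case False
    then show ?thesis using 3 by auto
  qed
qed auto

text \<open>A rooted tree is encoded by a parent function that fixes the root;
  \<open>desc p s\<close> is the subtree below \<open>s\<close>, with \<open>s\<close> included, and
  each link is represented by its lower end.\<close>

definition desc :: "('n \<Rightarrow> 'n) \<Rightarrow> 'n \<Rightarrow> 'n set" where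
  "desc p s = {x. \<exists>n. (p ^^ n) x = s}"

definition rooted_links :: "'n set \<Rightarrow> 'n \<Rightarrow> ('n \<Rightarrow> 'n) \<Rightarrow> 'n set set" where
  "rooted_links N r p = (\<lambda>x. {x, p x}) ` (N - {r})"

definition rooted_graph :: "'n set \<Rightarrow> 'n \<Rightarrow> ('n \<Rightarrow> 'n) \<Rightarrow> 'n sgraph" where
  "rooted_graph N r p = \<lparr>nodes = N, links = rooted_links N r p\<rparr>"

lemma rooted_graph_simps [simp]:
  "nodes (rooted_graph N r p) = N" "links (rooted_graph N r p) = rooted_links N r p"
  by (simp_all add: rooted_graph_def)

lemma desc_refl [simp]: "s \<in> desc p s"
  unfolding desc_def by (auto intro: exI[of _ 0])

lemma desc_trans: "x \<in> desc p y \<Longrightarrow> y \<in> desc p z \<Longrightarrow> x \<in> desc p z"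
proof -
  assume "x \<in> desc p y" "y \<in> desc p z"
  then obtain n m where "(p ^^ n) x = y" "(p ^^ m) y = z" by (auto simp: desc_def)
  then have "(p ^^ (m + n)) x = z" by (simp add: funpow_add)
  then show ?thesis unfolding desc_def by blast
qed

lemma desc_parent: "x \<in> desc p (p x)"
  unfolding desc_def by (auto intro: exI[of _ 1])

lemma desc_step: "x \<in> desc p s \<longleftrightarrow> x = s \<or> p x \<in> desc p s"
proof
  assume "x \<in> desc p s"
  then obtain n where "(p ^^ n) x = s" by (auto simp: desc_def)
  then show "x = s \<or> p x \<in> desc p s"
    by (cases n) (auto simp: desc_def funpow_swap1)
next
  assume "x = s \<or> p x \<in> desc p s"
  then show "x \<in> desc p s" using desc_parent desc_trans desc_refl by metis
qed

text \<open>Stop one step before the first visit to \<open>s\<close>. The child of \<open>s\<close>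
  is returned as an iterate of \<open>x\<close>, so that it is visibly above \<open>x\<close>; the
  second conjunct excludes the root as its own child.\<close>

lemma desc_child:
  assumes "x \<in> desc p s" "x \<noteq> s"
  shows "\<exists>n. p ((p ^^ n) x) = s \<and> (p ^^ n) x \<noteq> s"
proof -
  have ex: "\<exists>n. (p ^^ n) x = s" using assms by (simp add: desc_def)
  define m where "m = (LEAST n. (p ^^ n) x = s)"
  have m: "(p ^^ m) x = s" unfolding m_def using ex by (rule LeastI_ex)
  have "m \<noteq> 0" using m assms(2) by (metis funpow_0)
  then obtain k where k: "m = Suc k" by (cases m) auto
  have "(p ^^ k) x \<noteq> s" using not_less_Least[of k "\<lambda>n. (p ^^ n) x = s"] k m_def by auto
  moreover have "p ((p ^^ k) x) = s" using m k by simp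
  ultimately show ?thesis by blast
qed

lemma desc_linear:
  assumes "x \<in> desc p y" "x \<in> desc p z"
  shows "y \<in> desc p z \<or> z \<in> desc p y"
proof -
  obtain n m where nm: "(p ^^ n) x = y" "(p ^^ m) x = z" using assms by (auto simp: desc_def)
  show ?thesis
  proof (cases "n \<le> m")
    case True
    then have "(p ^^ (m - n)) y = z" using nm funpow_add[of "m - n" n p] by simp
    then show ?thesis unfolding desc_def by blast
  next
    case False
    then have "(p ^^ (n - m)) z = y" using nm funpow_add[of "n - m" m p] by simp
    then show ?thesis unfolding desc_def by blast
  qed
qed

locale rooted =
  fixes N :: "'n set" and r :: 'n and p :: "'n \<Rightarrow> 'n"
  assumes finite_nodes: "finite N"
    and root_in: "r \<in> N"
    and parent_root [simp]: "p r = r"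
    and parent_in: "x \<in> N \<Longrightarrow> p x \<in> N"
    and below_root: "x \<in> N \<Longrightarrow> x \<in> desc p r"
begin

lemma funpow_in: "x \<in> N \<Longrightarrow> (p ^^ n) x \<in> N"
  by (induction n) (auto intro: parent_in)

lemma desc_in: "x \<in> N \<Longrightarrow> x \<in> desc p s \<Longrightarrow> s \<in> N"
  using funpow_in by (auto simp: desc_def)

lemma funpow_root [simp]: "(p ^^ n) r = r"
  by (induction n) auto

lemma root_desc_iff: "r \<in> desc p s \<longleftrightarrow> s = r"
  by (auto simp: desc_def)

definition depth :: "'n \<Rightarrow> nat" where
  "depth x = (LEAST n. (p ^^ n) x = r)"

lemma depth_parent:
  assumes "x \<in> N" "x \<noteq> r"
  shows "depth x = Suc (depth (p x))"
proof -
  obtain n where "(p ^^ n) x = r" using below_root[OF assms(1)] by (auto simp: desc_def)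
  then have "depth x = Suc (LEAST m. (p ^^ Suc m) x = r)"
    unfolding depth_def using assms(2) by (intro Least_Suc) auto
  then show ?thesis unfolding depth_def by (simp add: funpow_swap1)
qed

lemma depth_desc:
  assumes "x \<in> N" "x \<in> desc p s"
  shows "depth s \<le> depth x"
proof -
  obtain n where "(p ^^ n) x = s" using assms(2) by (auto simp: desc_def)
  then show ?thesis using assms(1)
  proof (induction n arbitrary: x)
    case (Suc n)
    have "depth s \<le> depth (p x)" using Suc.IH[of "p x"] Suc.prems
      by (simp add: funpow_swap1 parent_in)
    then show ?case using depth_parent[OF Suc.prems(2)] by (cases "x = r") auto
  qed simp
qed

lemma desc_antisym:
  assumes "x \<in> N" "x \<in> desc p y" "y \<in> desc p x"
  shows "x = y"
proof (rule ccontr)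
  assume ne: "x \<noteq> y"
  then have px: "p x \<in> desc p y" using assms(2) desc_step by metis
  show False
  proof (cases "x = r")
    case True
    then show False using assms(2) ne root_desc_iff by auto
  next
    case False
    have "depth y \<le> depth (p x)" using depth_desc[OF parent_in[OF assms(1)] px] .
    moreover have "depth x \<le> depth y" using depth_desc[OF desc_in[OF assms(1,2)] assms(3)] .
    ultimately show False using depth_parent[OF assms(1) False] by simp
  qed
qed

lemma parent_neq: "x \<in> N \<Longrightarrow> x \<noteq> r \<Longrightarrow> p x \<noteq> x"
  using depth_parent[of x] by auto

text \<open>The ancestors of a node form a chain, so siblings with a common descendant would be
  comparable, and one of them would be an ancestor of its own parent.\<close>

lemma siblings_disjoint:
  assumes "c \<in> N" "c' \<in> N" "c \<noteq> r" "c' \<noteq> r" "p c = p c'" "c \<noteq> c'" "x \<in> N"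
    "x \<in> desc p c"
  shows "x \<notin> desc p c'"
proof
  assume "x \<in> desc p c'"
  then consider "c \<in> desc p c'" | "c' \<in> desc p c" using desc_linear assms(8) by metis
  then show False
  proof cases
    case 1
    then have "p c \<in> desc p c'" using assms(6) desc_step by metis
    then have "c' = p c'" using desc_antisym[OF assms(2)] assms(5) desc_parent by metis
    then show False using parent_neq assms by metis
  next
    case 2
    then have "p c' \<in> desc p c" using assms(6) desc_step by metis
    then have "c = p c" using desc_antisym[OF assms(1)] assms(5) desc_parent by metis
    then show False using parent_neq assms by metis
  qed
qed

lemma link_cases:
  assumes "{x, y} \<in> rooted_links N r p"
  shows "(x \<in> N \<and> x \<noteq> r \<and> y = p x) \<or> (y \<in> N \<and> y \<noteq> r \<and> x = p y)"
  using assms by (auto simp: rooted_links_def doubleton_eq_iff)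

lemma link_deeper:
  assumes "{x, y} \<in> rooted_links N r p" "depth y \<le> depth x"
  shows "y = p x"
  using link_cases[OF assms(1)] depth_parent[of y] assms(2) by auto

text \<open>Any two nodes are connected via the root. On a cycle, both neighbours of a deepest node
  would be its parent, hence equal.\<close>

lemma is_tree: "is_tree (rooted_graph N r p)"
  unfolding is_tree_def
proof (intro conjI)
  let ?T = "rooted_graph N r p"
  let ?R = "{(a, b). a \<in> nodes ?T \<and> b \<in> nodes ?T \<and> {a, b} \<in> links ?T}"
  show "fin_sgraph ?T"
    unfolding fin_sgraph_def
    using finite_nodes parent_in parent_neq by (auto simp: rooted_links_def card_2_iff)
  show "nodes ?T \<noteq> {}" using root_in by auto
  show "sg_connected ?T"
    unfolding sg_connected_def
  proof (intro ballI)
    fix s t assume st: "s \<in> nodes ?T" "t \<in> nodes ?T"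
    have up: "(x, r) \<in> ?R\<^sup>*" if "x \<in> N" for x
      using that
    proof (induction "depth x" arbitrary: x)
      case 0
      then show ?case using depth_parent by (cases "x = r") auto
    next
      case (Suc n)
      show ?case
      proof (cases "x = r")
        case False
        then have "(p x, r) \<in> ?R\<^sup>*"
          using Suc depth_parent[of x] parent_in by auto
        moreover have "(x, p x) \<in> ?R" using Suc.prems False parent_in by (auto simp: rooted_links_def)
        ultimately show ?thesis by (meson converse_rtrancl_into_rtrancl)
      qed simp
    qed
    have "sym ?R" by (auto simp: sym_def insert_commute)
    then have "sym (?R\<^sup>*)" by (rule sym_rtrancl)
    moreover have "(t, r) \<in> ?R\<^sup>*" using up[of t] st(2) by simp
    ultimately have "(r, t) \<in> ?R\<^sup>*" by (rule symD)
    moreover have "(s, r) \<in> ?R\<^sup>*" using up[of s] st(1) by simp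
    ultimately have "(s, t) \<in> ?R\<^sup>*" by (meson rtrancl_trans)
    then show "\<exists>q. sg_path ?T q \<and> hd q = s \<and> last q = t"
      by (rule rtrancl_imp_sg_path[OF _ st(2)])
  qed
  show "\<not> (\<exists>q. sg_cycle ?T q)"
  proof
    assume "\<exists>q. sg_cycle ?T q"
    then obtain q where q: "distinct q" "length q \<ge> 3" "{last q, hd q} \<in> rooted_links N r p"
      "successively (\<lambda>x y. {x, y} \<in> rooted_links N r p) q"
      by (auto simp: sg_cycle_def sg_path_def)
    let ?n = "length q"
    have adj: "{q ! i, q ! (Suc i mod ?n)} \<in> rooted_links N r p" if "i < ?n" for i
    proof (cases "Suc i = ?n")
      case True
      moreover have "q \<noteq> []" using q(2) by auto
      moreover have "i = ?n - 1" using True by simp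
      ultimately have "q ! i = last q" "q ! (Suc i mod ?n) = hd q"
        by (simp_all add: last_conv_nth hd_conv_nth)
      then show ?thesis using q(3) by simp
    next
      case False
      then have "Suc i < ?n" using that by simp
      then show ?thesis using q(4) successively_nth[of _ q i] by simp
    qed
    have "finite (depth ` set q)" "depth ` set q \<noteq> {}" using q(2) by auto
    then have "Max (depth ` set q) \<in> depth ` set q" by (rule Max_in)
    then obtain x where x: "x \<in> set q" "depth x = Max (depth ` set q)" by auto
    then have mx: "depth y \<le> depth x" if "y \<in> set q" for y using that by auto
    obtain i where i: "i < ?n" "q ! i = x" using x(1) by (auto simp: in_set_conv_nth)
    \<comment> \<open>Positions \<open>j\<close> and \<open>Suc i mod ?n\<close> are the two cyclic
      neighbours of \<open>i\<close>; they differ because the cycle has length at least 3.\<close>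
    define j where "j = (if i = 0 then ?n - 1 else i - 1)"
    have j: "j < ?n" "Suc j mod ?n = i" using i q(2) by (auto simp: j_def)
    have i': "Suc i mod ?n < ?n" using q(2) by (intro mod_less_divisor) linarith
    have "q ! (Suc i mod ?n) = p x"
      by (rule link_deeper) (use adj[OF i(1)] i(2) mx[OF nth_mem[OF i']] in simp_all)
    moreover have "q ! j = p x"
    proof (rule link_deeper)
      show "{x, q ! j} \<in> rooted_links N r p"
        using adj[OF j(1)] unfolding j(2) i(2) by (subst insert_commute)
      show "depth (q ! j) \<le> depth x" by (rule mx[OF nth_mem[OF j(1)]])
    qed
    moreover have "Suc i mod ?n \<noteq> j"
      using i(1) q(2) by (cases "Suc i = ?n") (auto simp: j_def split: if_splits)
    ultimately show False
      using nth_eq_iff_index_eq[OF q(1) i' j(1)] by simp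
  qed
qed

end

text \<open>The parent of a node is a neighbour with a shorter shortest path to \<open>t\<close>.
  The parent links form a connected subgraph, and any further link of \<open>T\<close> would close a
  cycle with a path in it.\<close>

lemma tree_rooted_at:
  assumes T: "is_tree T" and t: "t \<in> nodes T"
  obtains p where "rooted (nodes T) t p" "T = rooted_graph (nodes T) t p"
proof -
  have fin: "finite (nodes T)" and lk: "\<And>l. l \<in> links T \<Longrightarrow> l \<subseteq> nodes T \<and> card l = 2"
    using T by (auto simp: is_tree_def fin_sgraph_def)
  define P where "P x n \<longleftrightarrow> (\<exists>q. sg_path T q \<and> hd q = x \<and> last q = t \<and> length q = n)" for x n
  define d where "d x = (LEAST n. P x n)" for x
  have P_ex: "\<exists>n. P x n" if "x \<in> nodes T" for x
    using T t that unfolding P_def is_tree_def sg_connected_def by blast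
  have Pd: "P x (d x)" if "x \<in> nodes T" for x
    unfolding d_def using P_ex[OF that] by (rule LeastI_ex)
  have step: "\<exists>y. y \<in> nodes T \<and> {x, y} \<in> links T \<and> d y < d x" if x: "x \<in> nodes T" "x \<noteq> t" for x
  proof -
    obtain q where q: "sg_path T q" "hd q = x" "last q = t" "length q = d x"
      using Pd[OF x(1)] by (auto simp: P_def)
    obtain y zs where s: "q = x # y # zs"
      using q x(2) by (cases q; cases "tl q") (auto simp: sg_path_def)
    have "sg_path T (y # zs)" "{x, y} \<in> links T" "y \<in> nodes T" using q(1) by (auto simp: s sg_path_def)
    moreover from this have "P y (length (y # zs))" unfolding P_def using q(3) s by force
    then have "d y \<le> length (y # zs)" unfolding d_def by (rule Least_le)
    ultimately show ?thesis using q(4) s by auto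
  qed
  define p where "p x = (if x \<in> nodes T \<and> x \<noteq> t then SOME y. y \<in> nodes T \<and> {x, y} \<in> links T \<and> d y < d x else x)" for x
  have p: "p x \<in> nodes T \<and> {x, p x} \<in> links T \<and> d (p x) < d x" if "x \<in> nodes T" "x \<noteq> t" for x
    using someI_ex[OF step[OF that]] that by (simp add: p_def)
  have pin: "p x \<in> nodes T" if "x \<in> nodes T" for x
    using p that by (cases "x = t") (auto simp: p_def)
  have "x \<in> desc p t" if "x \<in> nodes T" for x
    using that
  proof (induction "d x" arbitrary: x rule: less_induct)
    case less
    show ?case
      using less p desc_refl desc_step[of x p t] by (cases "x = t") auto
  qed
  then have R: "rooted (nodes T) t p"
    using fin t pin by unfold_locales (auto simp: p_def)
  then interpret rooted "nodes T" t p .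
  let ?T0 = "rooted_graph (nodes T) t p"
  have sub: "links ?T0 \<subseteq> links T" using p by (auto simp: rooted_links_def)
  have "l \<in> links ?T0" if l: "l \<in> links T" for l
  proof (rule ccontr)
    assume no: "l \<notin> links ?T0"
    obtain x y where xy: "l = {x, y}" "x \<noteq> y" "x \<in> nodes T" "y \<in> nodes T"
      using lk[OF l] by (auto simp: card_2_iff)
    obtain q where q: "sg_path ?T0 q" "hd q = x" "last q = y"
      using is_tree xy unfolding is_tree_def sg_connected_def by force
    have "sg_path T q" using q(1) sub by (auto simp: sg_path_def elim!: successively_mono)
    \<comment> \<open>One node is impossible as \<open>x \<noteq> y\<close>, and two nodes would
      make \<open>l\<close> a parent link.\<close>
    moreover have "length q \<ge> 3"
    proof (rule ccontr)
      assume "\<not> ?thesis"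
      then consider "q = []" | a where "q = [a]" | a b where "q = [a, b]"
        by (cases q; cases "tl q"; cases "tl (tl q)") auto
      then show False using q xy no by cases (auto simp: sg_path_def)
    qed
    moreover have "{last q, hd q} \<in> links T" using q l xy by (simp add: insert_commute)
    ultimately have "sg_cycle T q" by (simp add: sg_cycle_def)
    then show False using T by (auto simp: is_tree_def)
  qed
  then have "links T = rooted_links (nodes T) t p" using sub by auto
  then have "T = ?T0" by (intro sgraph.equality) auto
  with R show ?thesis by (rule that)
qed

section \<open>Minimal subtrees of a rooted tree\<close>

definition splits :: "('n \<Rightarrow> 'n) \<Rightarrow> 'n set \<Rightarrow> 'n \<Rightarrow> bool" where
  "splits p L c \<longleftrightarrow> L \<inter> desc p c \<noteq> {} \<and> \<not> L \<subseteq> desc p c"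

context rooted
begin

text \<open>\<open>splits p L c\<close> says that the link from \<open>c\<close> to its parent
  separates two elements of \<open>L\<close>; these links and their ends form the minimal subtree.
  \<open>L\<close> is added explicitly for a singleton, which no link splits.\<close>

definition hull_nodes :: "'n set \<Rightarrow> 'n set" where
  "hull_nodes L = L \<union> {s. \<exists>c\<in>N - {r}. (c = s \<or> p c = s) \<and> splits p L c}"

definition hull :: "'n set \<Rightarrow> 'n sgraph" where
  "hull L = \<lparr>nodes = hull_nodes L, links = (\<lambda>c. {c, p c}) ` {c \<in> N - {r}. splits p L c}\<rparr>"

text \<open>For nonempty \<open>L\<close> the hull is again a rooted graph: its root is the least
  common ancestor \<open>m\<close> of \<open>L\<close>, and its parent function is \<open>p\<close>
  with \<open>m\<close> turned into a fixed point.\<close>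

lemma hull_subtree:
  assumes L: "L \<subseteq> N"
  shows "subtree (hull L) (rooted_graph N r p)"
proof (cases "L = {}")
  case True
  then show ?thesis
    by (auto simp: subtree_def sg_subgraph_def hull_def hull_nodes_def splits_def)
next
  case False
  have sub: "sg_subgraph (hull L) (rooted_graph N r p)"
    using L parent_in by (auto simp: sg_subgraph_def hull_def hull_nodes_def rooted_links_def)
  \<comment> \<open>Minimising the number of descendants among the common ancestors of
    \<open>L\<close> gives the lowest one.\<close>
  let ?f = "\<lambda>m. card (desc p m \<inter> N)"
  have "r \<in> N \<and> L \<subseteq> desc p r" using root_in L below_root by auto
  from ex_has_least_nat[of "\<lambda>m. m \<in> N \<and> L \<subseteq> desc p m" r ?f, OF this]
  obtain m where m: "m \<in> N" "L \<subseteq> desc p m"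
    and least: "\<And>y. y \<in> N \<Longrightarrow> L \<subseteq> desc p y \<Longrightarrow> ?f m \<le> ?f y"
    by blast
  have proper: "\<not> L \<subseteq> desc p s" if "s \<in> N" "s \<in> desc p m" "s \<noteq> m" for s
  proof
    assume "L \<subseteq> desc p s"
    then have "?f m \<le> ?f s" using least that(1) by blast
    moreover have "m \<notin> desc p s" using desc_antisym[OF that(1,2)] that(3) by blast
    then have "desc p s \<inter> N \<subset> desc p m \<inter> N" using that(2) m(1) desc_trans by fastforce
    then have "?f s < ?f m" using finite_nodes by (intro psubset_card_mono) auto
    ultimately show False by simp
  qed
  have split_below: "c \<in> desc p m \<and> c \<noteq> m" if c: "splits p L c" for c
  proof -
    obtain a where a: "a \<in> L" "a \<in> desc p c" using c by (auto simp: splits_def)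
    have "m \<notin> desc p c" using c m(2) desc_trans unfolding splits_def by (meson subset_iff)
    then show ?thesis using desc_linear[of a p c m] a m(2) by (metis desc_refl subset_iff)
  qed
  have below: "s \<in> desc p m \<and> s \<in> N" if s: "s \<in> hull_nodes L" for s
  proof -
    consider "s \<in> L" | "s \<in> N" "splits p L s" | c where "c \<in> N" "p c = s" "splits p L c"
      using s by (auto simp: hull_nodes_def)
    then show ?thesis
    proof cases
      case 3
      then show ?thesis using split_below[of c] parent_in desc_step[of c p m] by metis
    qed (use m L split_below in auto)
  qed
  have meets: "L \<inter> desc p s \<noteq> {}" if s: "s \<in> hull_nodes L" for s
  proof -
    consider "s \<in> L" | "splits p L s" | c where "p c = s" "splits p L c"
      using s by (auto simp: hull_nodes_def)
    then show ?thesis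
    proof cases
      case 1
      then show ?thesis using desc_refl by fast
    next
      case 3
      then obtain a where a: "a \<in> L" "a \<in> desc p c" by (auto simp: splits_def)
      then have "a \<in> desc p s" using desc_trans desc_parent 3(1) by metis
      then show ?thesis using a(1) by blast
    qed (auto simp: splits_def)
  qed
  have split: "splits p L s" if "s \<in> hull_nodes L" "s \<noteq> m" for s
    using meets[OF that(1)] proper below[OF that(1)] that(2) by (simp add: splits_def)
  have nr: "\<not> splits p L r" using L below_root by (auto simp: splits_def)
  \<comment> \<open>If \<open>m\<close> is not in \<open>L\<close>, the child of \<open>m\<close>
    above some element of \<open>L\<close> is not above all of \<open>L\<close>, by the choice of
    \<open>m\<close>, so its link to \<open>m\<close> splits \<open>L\<close>.\<close>
  have m_in: "m \<in> hull_nodes L"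
  proof (cases "m \<in> L")
    case False
    obtain a where a: "a \<in> L" using \<open>L \<noteq> {}\<close> by blast
    then have "a \<in> desc p m" "a \<noteq> m" using m(2) False by auto
    then obtain n where n: "p ((p ^^ n) a) = m" "(p ^^ n) a \<noteq> m" using desc_child by metis
    let ?c = "(p ^^ n) a"
    have c: "?c \<in> N" using a L funpow_in by auto
    have "a \<in> desc p ?c" by (auto simp: desc_def)
    moreover have "\<not> L \<subseteq> desc p ?c"
      using proper[OF c _ n(2)] desc_parent n(1) by metis
    ultimately have "splits p L ?c" using a by (auto simp: splits_def)
    then show ?thesis using c n(1) nr by (auto simp: hull_nodes_def)
  qed (simp add: hull_nodes_def)
  define p' where "p' = p(m := m)"
  have p'_simps: "p' m = m" "\<And>s. s \<noteq> m \<Longrightarrow> p' s = p s" by (simp_all add: p'_def)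
  have reach: "s \<in> desc p' m" if s: "s \<in> desc p m" for s
  proof -
    obtain n where "(p ^^ n) s = m" using s by (auto simp: desc_def)
    then show ?thesis
    proof (induction n arbitrary: s)
      case (Suc n)
      show ?case
      proof (cases "s = m")
        case False
        have "(p ^^ n) (p s) = m" using Suc.prems by (simp add: funpow_swap1)
        then have "p s \<in> desc p' m" by (rule Suc.IH)
        then show ?thesis using False desc_step[of s p' m] by (simp add: p'_simps)
      qed simp
    qed simp
  qed
  have "rooted (hull_nodes L) m p'"
  proof
    show "finite (hull_nodes L)" using below finite_nodes by (meson finite_subset subsetI)
    show "m \<in> hull_nodes L" by (rule m_in)
    show "p' x \<in> hull_nodes L" if "x \<in> hull_nodes L" for x
    proof (cases "x = m")
      case False
      then show ?thesis using split[OF that False] below[OF that] nr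
        by (auto simp: hull_nodes_def p'_simps)
    qed (simp add: m_in p'_simps)
    show "x \<in> desc p' m" if "x \<in> hull_nodes L" for x
      using reach below that by auto
  qed (simp add: p'_simps)
  then have "is_tree (rooted_graph (hull_nodes L) m p')" by (rule rooted.is_tree)
  moreover have "rooted_graph (hull_nodes L) m p' = hull L"
  proof -
    have "hull_nodes L - {m} = {c \<in> N - {r}. splits p L c}"
    proof (intro equalityI subsetI)
      fix s assume "s \<in> hull_nodes L - {m}"
      then have "splits p L s" "s \<in> N" using split below by auto
      then show "s \<in> {c \<in> N - {r}. splits p L c}" using nr by auto
    next
      fix s assume "s \<in> {c \<in> N - {r}. splits p L c}"
      then show "s \<in> hull_nodes L - {m}" using split_below unfolding hull_nodes_def by blast
    qed
    moreover have "rooted_links (hull_nodes L) m p' = (\<lambda>c. {c, p c}) ` (hull_nodes L - {m})"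
      unfolding rooted_links_def by (rule image_cong) (auto simp: p'_simps)
    ultimately show ?thesis by (simp add: rooted_graph_def hull_def)
  qed
  ultimately show ?thesis using sub by (simp add: subtree_def)
qed

text \<open>A path in \<open>S\<close> between elements of \<open>L\<close> on both sides of a
  splitting link must use that link, as no other link leaves \<open>desc p c\<close>.\<close>

lemma hull_least:
  assumes S: "subtree S (rooted_graph N r p)" and L: "L \<subseteq> nodes S"
  shows "sg_subgraph (hull L) S"
proof -
  have link: "{c, p c} \<in> links S \<and> c \<in> nodes S \<and> p c \<in> nodes S"
    if c: "c \<in> N - {r}" "splits p L c" for c
  proof -
    obtain a b where ab: "a \<in> L" "a \<in> desc p c" "b \<in> L" "b \<notin> desc p c"
      using c(2) by (auto simp: splits_def)
    then have "is_tree S" using S L by (auto simp: subtree_def)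
    then obtain q where q: "sg_path S q" "hd q = a" "last q = b"
      using ab L unfolding is_tree_def sg_connected_def by blast
    then obtain u w where uw: "u \<in> nodes S" "w \<in> nodes S" "u \<in> desc p c" "w \<notin> desc p c"
      "{u, w} \<in> links S"
      using successively_crossing[of "\<lambda>x y. {x, y} \<in> links S" q "desc p c"] ab
      unfolding sg_path_def by blast
    then have "{u, w} \<in> rooted_links N r p" using S by (auto simp: subtree_def sg_subgraph_def)
    from link_cases[OF this] have "u = c \<and> w = p c"
      using uw(3,4) desc_step[of u p c] desc_step[of w p c] by auto
    then show ?thesis using uw by simp
  qed
  then show ?thesis using L by (auto simp: sg_subgraph_def hull_def hull_nodes_def)
qed

text \<open>Since the hull lies in every subtree containing \<open>L\<close>, it is the unique
  minimal one and the definite description is met.\<close>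

lemma minimal_subtree_eq:
  assumes L: "L \<subseteq> N"
  shows "minimal_subtree (rooted_graph N r p) L = hull L"
  unfolding minimal_subtree_def
proof (rule the_equality)
  have LH: "L \<subseteq> nodes (hull L)" by (auto simp: hull_def hull_nodes_def)
  have anti: "S = S'" if "sg_subgraph S S'" "sg_subgraph S' S" for S S' :: "'n sgraph"
    using that by (intro sgraph.equality) (auto simp: sg_subgraph_def)
  show "subtree (hull L) (rooted_graph N r p) \<and> L \<subseteq> nodes (hull L) \<and>
    (\<forall>S'. subtree S' (rooted_graph N r p) \<and> L \<subseteq> nodes S' \<and> sg_subgraph S' (hull L) \<longrightarrow> S' = hull L)"
    using hull_subtree[OF L] LH hull_least anti by blast
  show "S = hull L" if "subtree S (rooted_graph N r p) \<and> L \<subseteq> nodes S \<and>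
    (\<forall>S'. subtree S' (rooted_graph N r p) \<and> L \<subseteq> nodes S' \<and> sg_subgraph S' S \<longrightarrow> S' = S)" for S
    using that hull_subtree[OF L] LH hull_least by metis
qed

text \<open>Edge-bags are intersections of node-bags, so a link with both ends in the hull has to be
  a hull link. Otherwise \<open>L\<close> lies entirely on one side of it, and the end on the other
  side is not in the hull.\<close>

lemma hull_link:
  assumes L: "L \<subseteq> N" and c: "c \<in> N" "c \<noteq> r" "c \<in> hull_nodes L" "p c \<in> hull_nodes L"
  shows "splits p L c"
proof (rule ccontr)
  assume no: "\<not> splits p L c"
  then consider "L \<inter> desc p c = {}" | "L \<subseteq> desc p c" by (auto simp: splits_def)
  then show False
  proof cases
    case 1
    then have "c \<notin> L" using desc_refl by fast
    then obtain c' where c': "p c' = c" "splits p L c'" using c(3) no by (auto simp: hull_nodes_def)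
    then obtain a where a: "a \<in> L" "a \<in> desc p c'" by (auto simp: splits_def)
    have "a \<in> desc p c" using desc_trans[OF a(2) desc_parent] c'(1) by simp
    then show False using 1 a(1) by blast
  next
    case 2
    have up: "L \<subseteq> desc p (p c)" using 2 desc_trans[OF _ desc_parent[of c p]] by auto
    have "p c \<notin> L"
      using 2 desc_antisym[OF c(1) desc_parent] parent_neq[OF c(1,2)] by auto
    then obtain c' where c': "c' \<in> N" "c' \<noteq> r" "c' = p c \<or> p c' = p c" "splits p L c'"
      using c(4) by (auto simp: hull_nodes_def)
    from c'(4) obtain a where a: "a \<in> L" "a \<in> desc p c'" by (auto simp: splits_def)
    have "c' \<noteq> p c" "c' \<noteq> c" using c'(4) up no by (auto simp: splits_def)
    then have "a \<notin> desc p c"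
      using siblings_disjoint[OF c'(1) c(1) c'(2) c(2)] c'(3) a L by blast
    then show False using a 2 by auto
  qed
qed

end

section \<open>Bags and adhesion sets of rooted decompositions\<close>

definition inc :: "('v, 'e) mgraph \<Rightarrow> 'e set \<Rightarrow> 'v set" where
  "inc G F = \<Union> (ends G ` F)"

definition bd :: "('v, 'e) mgraph \<Rightarrow> 'e set \<Rightarrow> 'v set" where
  "bd G F = inc G F \<inter> inc G (edges G - F)"

text \<open>The leaf map is a parameter so that trees over other node types, such as the doubled
  tree, can carry the edges of \<open>G\<close>.\<close>

definition below :: "('v, 'e) mgraph \<Rightarrow> ('e \<Rightarrow> 'n) \<Rightarrow> ('n \<Rightarrow> 'n) \<Rightarrow> 'n \<Rightarrow> 'e set" where
  "below G leaf p s = {e \<in> edges G. leaf e \<in> desc p s}"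

text \<open>The node-bag as a union of adhesion sets: \<open>c = s\<close> gives the link to the
  parent, \<open>p c = s\<close> the links to the children. The first term supplies the ends of an
  edge at \<open>s\<close> that meet no other edge.\<close>

definition rbag ::
  "('v, 'e) mgraph \<Rightarrow> ('e \<Rightarrow> 'n) \<Rightarrow> 'n set \<Rightarrow> 'n \<Rightarrow> ('n \<Rightarrow> 'n) \<Rightarrow> 'n \<Rightarrow> 'v set" where
  "rbag G leaf N r p s = inc G {e \<in> edges G. leaf e = s} \<union>
     (\<Union>c\<in>{c \<in> N - {r}. c = s \<or> p c = s}. bd G (below G leaf p c))"

lemma inc_Un: "inc G (A \<union> B) = inc G A \<union> inc G B"
  by (auto simp: inc_def)

lemma inc_mono: "A \<subseteq> B \<Longrightarrow> inc G A \<subseteq> inc G B"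
  by (auto simp: inc_def)

lemma inc_empty [simp]: "inc G {} = {}"
  by (simp add: inc_def)

lemma inc_subset_verts: "fin_mgraph G \<Longrightarrow> F \<subseteq> edges G \<Longrightarrow> inc G F \<subseteq> verts G"
  by (auto simp: inc_def fin_mgraph_def)

lemma finite_inc: "fin_mgraph G \<Longrightarrow> F \<subseteq> edges G \<Longrightarrow> finite (inc G F)"
  by (rule finite_subset[OF inc_subset_verts]) (auto simp: fin_mgraph_def)

lemma bd_subset_inc: "bd G F \<subseteq> inc G F"
  by (auto simp: bd_def)

lemma bd_Diff: "F \<subseteq> edges G \<Longrightarrow> bd G (edges G - F) = bd G F"
  by (auto simp: bd_def double_diff)

lemma below_subset: "below G leaf p s \<subseteq> edges G"
  by (auto simp: below_def)

lemma below_mono: "s \<in> desc p t \<Longrightarrow> below G leaf p s \<subseteq> below G leaf p t"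
  using desc_trans[of _ p s t] by (auto simp: below_def)

lemma rbag_subset_inc: "rbag G leaf N r p s \<subseteq> inc G (edges G)"
proof -
  have "bd G (below G leaf p c) \<subseteq> inc G (edges G)" for c
    using bd_subset_inc inc_mono[OF below_subset] by (rule subset_trans)
  moreover have "inc G {e \<in> edges G. leaf e = s} \<subseteq> inc G (edges G)" by (rule inc_mono) auto
  ultimately show ?thesis unfolding rbag_def by blast
qed

lemma finite_rbag: "fin_mgraph G \<Longrightarrow> finite (rbag G leaf N r p s)"
  by (rule finite_subset[OF rbag_subset_inc finite_inc[OF _ order_refl]])

text \<open>This turns hulls of leaf sets into boundaries of edge sets: the subtree of
  \<open>v\<close> uses a link when \<open>v\<close> meets edges on both sides of it.\<close>

lemma splits_iff_bd:
  "splits p (leaf ` {e \<in> edges G. v \<in> ends G e}) c \<longleftrightarrow> v \<in> bd G (below G leaf p c)"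
  by (auto simp: splits_def bd_def inc_def below_def)

lemma node_bag_rooted_graph:
  assumes "rooted N r p" "fin_mgraph G" "Inl ` edges G \<subseteq> N"
  shows "node_bag G (rooted_graph N r p) s = rbag G Inl N r p s"
proof -
  interpret rooted N r p by fact
  have sub: "Inl ` {e \<in> edges G. v \<in> ends G e} \<subseteq> N" for v using assms(3) by auto
  have "node_bag G (rooted_graph N r p) s = {v \<in> verts G. s \<in> hull_nodes (Inl ` {e \<in> edges G. v \<in> ends G e})}"
    unfolding node_bag_def vertex_subtree_def minimal_subtree_eq[OF sub] by (simp add: hull_def)
  also have "\<dots> = {v \<in> verts G. v \<in> rbag G Inl N r p s}"
    unfolding hull_nodes_def rbag_def splits_iff_bd by (auto simp: inc_def)
  also have "\<dots> = rbag G Inl N r p s"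
    using rbag_subset_inc inc_subset_verts[OF assms(2) order_refl] by fastforce
  finally show ?thesis .
qed

lemma edge_bag_rooted_graph:
  assumes "rooted N r p" "fin_mgraph G" "Inl ` edges G \<subseteq> N" "c \<in> N" "c \<noteq> r"
  shows "edge_bag G (rooted_graph N r p) {c, p c} = bd G (below G Inl p c)"
proof -
  interpret rooted N r p by fact
  let ?L = "\<lambda>v. Inl ` {e \<in> edges G. v \<in> ends G e}"
  have sub: "?L v \<subseteq> N" for v using assms(3) by auto
  have nb: "node_bag G (rooted_graph N r p) s = {v \<in> verts G. s \<in> hull_nodes (?L v)}" for s
    unfolding node_bag_def vertex_subtree_def minimal_subtree_eq[OF sub] by (simp add: hull_def)
  have "c \<in> hull_nodes (?L v) \<and> p c \<in> hull_nodes (?L v) \<longleftrightarrow> splits p (?L v) c" for v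
    using hull_link[OF sub assms(4,5)] assms(4,5) unfolding hull_nodes_def by blast
  then have "edge_bag G (rooted_graph N r p) {c, p c} = {v \<in> verts G. v \<in> bd G (below G Inl p c)}"
    unfolding edge_bag_def nb splits_iff_bd by auto
  also have "\<dots> = bd G (below G Inl p c)"
    using bd_subset_inc inc_subset_verts[OF assms(2) below_subset] by fastforce
  finally show ?thesis .
qed

lemma adhesion_rooted_graph:
  assumes "rooted N r p" "fin_mgraph G" "Inl ` edges G \<subseteq> N"
  shows "adhesion G (rooted_graph N r p) < \<theta> \<longleftrightarrow>
    0 < \<theta> \<and> (\<forall>c\<in>N - {r}. card (bd G (below G Inl p c)) < \<theta>)"
proof -
  interpret rooted N r p by fact
  have "(\<lambda>l. card (edge_bag G (rooted_graph N r p) l)) ` rooted_links N r p =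
    (\<lambda>c. card (bd G (below G Inl p c))) ` (N - {r})"
    unfolding rooted_links_def image_image
    using edge_bag_rooted_graph[OF assms] by (intro image_cong) auto
  then show ?thesis unfolding adhesion_def using finite_nodes by auto
qed

section \<open>Realising rooted decompositions, leaf bags, and a star\<close>

lemma rooted_decomposition_realized:
  fixes N :: "'n set" and G :: "('v, 'e) mgraph"
  assumes R: "rooted N r p" and G: "fin_mgraph G"
    and leaf: "leaf ` edges G \<subseteq> N" "inj_on leaf (edges G)"
    and no_child: "\<And>e. e \<in> edges G \<Longrightarrow> leaf e \<noteq> r"
      "\<And>e x. e \<in> edges G \<Longrightarrow> x \<in> N \<Longrightarrow> p x \<noteq> leaf e"
  obtains T \<phi> where "tree_decomposition G T" "bij_betw \<phi> N (nodes T)"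
    "\<And>s. s \<in> N \<Longrightarrow> node_bag G T (\<phi> s) = rbag G leaf N r p s"
    "\<And>\<theta>. 0 < \<theta> \<Longrightarrow> (\<And>c. c \<in> N - {r} \<Longrightarrow> card (bd G (below G leaf p c)) < \<theta>) \<Longrightarrow> adhesion G T < \<theta>"
proof -
  interpret rooted N r p by fact
  let ?E = "edges G"
  obtain g :: "'n \<Rightarrow> nat" where g: "inj_on g N"
    using finite_imp_inj_to_nat_seg[OF finite_nodes] by blast
  \<comment> \<open>Nodes that carry an edge are renamed to that edge, all others to natural
    numbers; the parent function is then transported along \<open>\<phi>\<close>.\<close>
  define \<phi> :: "'n \<Rightarrow> 'e + nat" where
    "\<phi> s = (if s \<in> leaf ` ?E then Inl (the_inv_into ?E leaf s) else Inr (g s))" for s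
  have \<phi>_leaf: "\<phi> (leaf e) = Inl e" if "e \<in> ?E" for e
    using that the_inv_into_f_f[OF leaf(2)] by (simp add: \<phi>_def)
  have inj: "inj_on \<phi> N"
  proof (rule inj_onI)
    fix x y assume "x \<in> N" "y \<in> N" "\<phi> x = \<phi> y"
    then show "x = y"
      using g by (auto simp: \<phi>_def inj_on_eq_iff the_inv_into_f_f[OF leaf(2)] split: if_splits)
  qed
  define N' where "N' = \<phi> ` N"
  define p' where "p' y = \<phi> (p (the_inv_into N \<phi> y))" for y
  have p': "p' (\<phi> x) = \<phi> (p x)" if "x \<in> N" for x
    using that by (simp add: p'_def the_inv_into_f_f[OF inj])
  have pow: "(p' ^^ n) (\<phi> x) = \<phi> ((p ^^ n) x)" if "x \<in> N" for n x
    using that by (induction n) (auto simp: p' funpow_in)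
  have eq: "\<phi> x = \<phi> y \<longleftrightarrow> x = y" if "x \<in> N" "y \<in> N" for x y
    using inj that by (auto simp: inj_on_eq_iff)
  have desc: "\<phi> x \<in> desc p' (\<phi> s) \<longleftrightarrow> x \<in> desc p s" if "x \<in> N" "s \<in> N" for x s
    using that by (simp add: desc_def pow eq funpow_in)
  have R': "rooted N' (\<phi> r) p'"
    using finite_nodes root_in by unfold_locales (auto simp: N'_def p' desc below_root parent_in)
  then interpret R': rooted N' "\<phi> r" p' .
  have leaf': "Inl ` ?E \<subseteq> N'"
    using leaf(1) \<phi>_leaf unfolding N'_def by (metis image_subset_iff imageI)
  have below_eq: "below G Inl p' (\<phi> s) = below G leaf p s" if "s \<in> N" for s
    unfolding below_def using desc[OF _ that] leaf(1) \<phi>_leaf by (auto simp flip: \<phi>_leaf)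
  have rbag_eq: "rbag G Inl N' (\<phi> r) p' (\<phi> s) = rbag G leaf N r p s" if "s \<in> N" for s
  proof -
    have "{e \<in> ?E. Inl e = \<phi> s} = {e \<in> ?E. leaf e = s}"
      using eq[OF _ that] leaf(1) by (auto simp flip: \<phi>_leaf)
    moreover have "{c \<in> N' - {\<phi> r}. c = \<phi> s \<or> p' c = \<phi> s} = \<phi> ` {c \<in> N - {r}. c = s \<or> p c = s}"
      using that root_in by (auto simp: N'_def eq p' parent_in)
    moreover have "(\<Union>c\<in>\<phi> ` {c \<in> N - {r}. c = s \<or> p c = s}. bd G (below G Inl p' c)) =
      (\<Union>c\<in>{c \<in> N - {r}. c = s \<or> p c = s}. bd G (below G leaf p c))"
      by (auto simp: below_eq)
    ultimately show ?thesis unfolding rbag_def by simp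
  qed
  let ?T = "rooted_graph N' (\<phi> r) p'"
  \<comment> \<open>A node carrying an edge is neither the root nor a parent, so the link to its own
    parent is the only one at it.\<close>
  have "Inl e \<in> leaves ?T" if e: "e \<in> ?E" for e
  proof -
    have le: "leaf e \<in> N" using leaf(1) e by auto
    have "{l \<in> links ?T. Inl e \<in> l} = {{Inl e, p' (Inl e)}}"
    proof (intro equalityI subsetI)
      fix l assume "l \<in> {l \<in> links ?T. Inl e \<in> l}"
      then obtain x where x: "x \<in> N" "l = {\<phi> x, \<phi> (p x)}" "Inl e = \<phi> x \<or> Inl e = \<phi> (p x)"
        unfolding rooted_links_def N'_def rooted_graph_simps using p' by fastforce
      have "\<phi> (leaf e) \<noteq> \<phi> (p x)" using no_child(2)[OF e x(1)] eq[OF le parent_in[OF x(1)]] by auto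
      then have "\<phi> x = Inl e" using x(3) \<phi>_leaf[OF e] by auto
      then show "l \<in> {{Inl e, p' (Inl e)}}" using x p' by fastforce
    next
      fix l assume "l \<in> {{Inl e, p' (Inl e)}}"
      moreover have "Inl e \<noteq> \<phi> r" using no_child(1)[OF e] eq[OF le root_in] \<phi>_leaf[OF e] by auto
      ultimately show "l \<in> {l \<in> links ?T. Inl e \<in> l}" using leaf' e by (auto simp: rooted_links_def)
    qed
    then show ?thesis using leaf' e by (auto simp: leaves_def)
  qed
  then have td: "tree_decomposition G ?T"
    using R'.is_tree by (auto simp: tree_decomposition_def)
  show ?thesis
  proof (rule that[of ?T \<phi>])
    show "tree_decomposition G ?T" by (rule td)
    show "bij_betw \<phi> N (nodes ?T)" using inj by (simp add: bij_betw_def N'_def)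
    show "node_bag G ?T (\<phi> s) = rbag G leaf N r p s" if "s \<in> N" for s
      using node_bag_rooted_graph[OF R' G leaf'] rbag_eq[OF that] by simp
    show "adhesion G ?T < \<theta>" if "0 < \<theta>" "\<And>c. c \<in> N - {r} \<Longrightarrow> card (bd G (below G leaf p c)) < \<theta>" for \<theta>
      unfolding adhesion_rooted_graph[OF R' G leaf']
    proof (intro conjI ballI)
      fix c assume "c \<in> N' - {\<phi> r}"
      then obtain x where "c = \<phi> x" "x \<in> N - {r}" by (auto simp: N'_def)
      then show "card (bd G (below G Inl p' c)) < \<theta>" using that(2) by (simp add: below_eq)
    qed (rule that(1))
  qed
qed

text \<open>An edge belongs to one side of a separation, so those of its ends that are on the other
  side lie in both.\<close>

lemma theta_connected_ends:
  assumes G: "fin_mgraph G" and e: "e \<in> edges G"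
  shows "theta_connected \<theta> G (ends G e)"
  unfolding theta_connected_def
proof (intro conjI allI impI)
  show "ends G e \<subseteq> verts G" using assms by (auto simp: fin_mgraph_def)
  fix G1 G2 assume "separation G G1 G2 \<and> sep_order G1 G2 < \<theta>"
  then have S: "separation G G1 G2" ..
  then have fin: "finite (verts G1 \<inter> verts G2)"
    by (auto simp: separation_def subgraph_of_def fin_mgraph_def)
  have "ends G e \<subseteq> verts G1 \<or> ends G e \<subseteq> verts G2"
    using S e unfolding separation_def subgraph_of_def fin_mgraph_def by (metis UnE)
  then have "ends G e \<inter> verts G2 \<subseteq> verts G1 \<inter> verts G2 \<or> ends G e \<inter> verts G1 \<subseteq> verts G1 \<inter> verts G2"
    by blast
  then show "min (card (ends G e \<inter> verts G1)) (card (ends G e \<inter> verts G2)) \<le> sep_order G1 G2"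
    unfolding sep_order_def using card_mono[OF fin] by (auto simp: min_le_iff_disj)
qed

text \<open>With the tree rooted at the leaf itself, all other edges lie below its single child, so
  the boundary there consists of ends of \<open>e\<close>.\<close>

lemma node_bag_leaf:
  assumes G: "fin_mgraph G" and T: "tree_decomposition G T" and e: "e \<in> edges G"
  shows "node_bag G T (Inl e) = ends G e"
proof -
  have t: "is_tree T" and lv: "Inl ` edges G \<subseteq> leaves T" using T by (auto simp: tree_decomposition_def)
  have sub: "Inl ` edges G \<subseteq> nodes T" using lv by (auto simp: leaves_def)
  let ?r = "Inl e" and ?N = "nodes T"
  obtain p where R: "rooted ?N ?r p" and Tp: "T = rooted_graph ?N ?r p"
    using tree_rooted_at[OF t] sub e by blast
  interpret rooted ?N ?r p by fact
  have "card {l \<in> links T. ?r \<in> l} = 1" using lv e by (auto simp: leaves_def)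
  then obtain l where l: "{l \<in> links T. ?r \<in> l} = {l}" by (auto simp: card_1_singleton_iff)
  have "bd G (below G Inl p c) \<subseteq> ends G e" if c: "c \<in> ?N - {?r}" "p c = ?r" for c
  proof -
    have "f \<in> below G Inl p c" if f: "f \<in> edges G" "f \<noteq> e" for f
    proof -
      have "Inl f \<in> ?N" using sub f by auto
      moreover have "Inl f \<noteq> ?r" using f by auto
      ultimately obtain n where n: "p ((p ^^ n) (Inl f)) = ?r" "(p ^^ n) (Inl f) \<noteq> ?r"
        using desc_child[OF below_root] by metis
      let ?c = "(p ^^ n) (Inl f)"
      have "{c', p c'} \<in> {l \<in> links T. ?r \<in> l}" if "c' \<in> ?N - {?r}" "p c' = ?r" for c'
        using that by (subst Tp) (auto simp: rooted_links_def)
      then have "{c, ?r} = l" "{?c, ?r} = l"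
        unfolding l using c n funpow_in[OF \<open>Inl f \<in> ?N\<close>] by (metis Diff_iff singletonD)+
      then have "?c = c" using c by (auto simp: doubleton_eq_iff)
      then show ?thesis using f by (auto simp: below_def desc_def)
    qed
    then have "edges G - below G Inl p c \<subseteq> {e}" by auto
    then show ?thesis unfolding bd_def inc_def by blast
  qed
  then have "rbag G Inl ?N ?r p ?r = ends G e"
    using e unfolding rbag_def by (auto simp: inc_def)
  then show ?thesis using node_bag_rooted_graph[OF R G sub] Tp by metis
qed

text \<open>A star with centre \<open>None\<close> and one leaf per edge: below each leaf lies a
  single edge, which has at most two ends.\<close>

lemma exists_tree_decomposition_adhesion_less_3:
  assumes G: "fin_mgraph G"
  shows "\<exists>T. tree_decomposition G T \<and> adhesion G T < 3"
proof -
  let ?N = "insert None (Some ` edges G)" and ?p = "\<lambda>_ :: 'b option. None"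
  have R: "rooted ?N None ?p"
    using G by unfold_locales (auto simp: fin_mgraph_def desc_step[of "Some _"])
  have "below G Some ?p (Some e) \<subseteq> {e}" for e
  proof -
    have "f = e" if f: "Some f \<in> desc ?p (Some e)" for f
    proof -
      obtain n where "(?p ^^ n) (Some f) = Some e" using f by (auto simp: desc_def)
      then show ?thesis by (cases n) auto
    qed
    then show ?thesis by (auto simp: below_def)
  qed
  then have bd: "bd G (below G Some ?p (Some e)) \<subseteq> ends G e" for e
    using bd_subset_inc inc_mono by (fastforce simp: inc_def)
  have small: "card (bd G (below G Some ?p c)) < 3" if c: "c \<in> ?N - {None}" for c
  proof -
    obtain e where e: "c = Some e" "e \<in> edges G" using c by auto
    have "card (ends G e) \<in> {1, 2}" using G e by (auto simp: fin_mgraph_def)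
    then have "card (ends G e) \<le> 2" "finite (ends G e)" by (auto intro: card_ge_0_finite)
    then show ?thesis using card_mono[OF _ bd[of e]] e by fastforce
  qed
  have leaf: "Some ` edges G \<subseteq> ?N" "inj_on Some (edges G)" by auto
  show ?thesis
  proof (rule rooted_decomposition_realized[OF R G leaf])
    fix T \<phi> assume T: "tree_decomposition G T"
      "\<And>\<theta>. 0 < \<theta> \<Longrightarrow> (\<And>c. c \<in> ?N - {None} \<Longrightarrow> card (bd G (below G Some ?p c)) < \<theta>) \<Longrightarrow> adhesion G T < \<theta>"
    have "adhesion G T < 3" by (rule T(2)) (use small in simp_all)
    with T(1) show ?thesis by blast
  qed simp_all
qed

section \<open>Uncrossing\<close>

lemma card_Diff_le_iff:
  assumes "finite S" "finite S'"
  shows "card (S - S') \<le> card (S' - S) \<longleftrightarrow> card S \<le> card S'"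
    and "card (S - S') = card (S' - S) \<longleftrightarrow> card S = card S'"
proof -
  have "card S = card (S - S') + card (S \<inter> S')" "card S' = card (S' - S) + card (S \<inter> S')"
    using assms card_Int_Diff[of S S'] card_Int_Diff[of S' S] by (simp_all add: Int_commute)
  then show "card (S - S') \<le> card (S' - S) \<longleftrightarrow> card S \<le> card S'"
    "card (S - S') = card (S' - S) \<longleftrightarrow> card S = card S'" by simp_all
qed

text \<open>
  The boundary of \<open>A\<close> after adding \<open>Z1\<close> as a hyperedge to \<open>A\<close> and \<open>Z2\<close> as a hyperedge to its complement.
\<close>

definition cut_set :: "('v, 'e) mgraph \<Rightarrow> 'v set \<Rightarrow> 'v set \<Rightarrow> 'e set \<Rightarrow> 'v set" where
  "cut_set G Z1 Z2 A = (inc G A \<union> Z1) \<inter> (inc G (edges G - A) \<union> Z2)"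

lemma cut_set_commute: "A \<subseteq> edges G \<Longrightarrow> cut_set G Z2 Z1 (edges G - A) = cut_set G Z1 Z2 A"
  by (auto simp: cut_set_def double_diff)

lemma finite_cut_set:
  "fin_mgraph G \<Longrightarrow> finite Z1 \<Longrightarrow> finite Z2 \<Longrightarrow> A \<subseteq> edges G \<Longrightarrow> finite (cut_set G Z1 Z2 A)"
  by (auto simp: cut_set_def finite_inc)

text \<open>
  For a node \<open>s\<close> with \<open>D = D s\<close> and \<open>\<C>\<close> the sets \<open>D c\<close> of its children, this is the bag of the copy of \<open>s\<close>
  that keeps the edges of \<open>A\<close>; taking all edges for \<open>A\<close> gives the original bag.
\<close>

definition shore :: "('v, 'e) mgraph \<Rightarrow> 'e set \<Rightarrow> 'e set set \<Rightarrow> 'e set \<Rightarrow> 'v set" where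
  "shore G D \<C> A = bd G (D \<inter> A) \<union> (\<Union>X\<in>\<C>. bd G (X \<inter> A))"

text \<open>The setting for comparing \<open>A\<close> with \<open>A \<union> D\<close>. By the last
  hypothesis no vertex of \<open>Z1\<close> or \<open>Z2\<close> that meets \<open>D\<close> has all
  its edges in \<open>D\<close>; this holds for subsets of the root bag.\<close>

locale uncrossing =
  fixes G :: "('v, 'e) mgraph" and Z1 Z2 :: "'v set" and D :: "'e set" and \<C> :: "'e set set"
  assumes G: "fin_mgraph G" and finZ: "finite Z1" "finite Z2"
    and D: "D \<subseteq> edges G" and \<C>: "\<And>X. X \<in> \<C> \<Longrightarrow> X \<subseteq> D"
    and Z: "(Z1 \<union> Z2) \<inter> inc G D \<subseteq> inc G (edges G - D)"
begin

abbreviation "E \<equiv> edges G"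
abbreviation "Y \<equiv> shore G D \<C> E"

text \<open>The vertices that the bag of a copy may gain; for \<open>A \<subseteq> E\<close> the set
  is the same for \<open>A\<close> and \<open>E - A\<close>.\<close>

definition "stray A = inc G A \<inter> inc G (E - A) \<inter> inc G D - Y"

lemma bd_D: "bd G D \<subseteq> Y"
  using D by (auto simp: shore_def Int_absorb2)

lemma shore_subset: "A \<subseteq> E \<Longrightarrow> shore G D \<C> A \<subseteq> inc G (A \<inter> D)"
  using \<C> unfolding shore_def bd_def inc_def by blast

lemma finite_shore: "A \<subseteq> E \<Longrightarrow> finite (shore G D \<C> A)"
  by (rule finite_subset[OF shore_subset]) (use G in \<open>auto intro!: finite_inc\<close>)

lemma bd_Int_subset:
  assumes "A \<subseteq> E" "X \<subseteq> E" "v \<in> bd G (X \<inter> A)" "v \<notin> bd G X"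
  shows "v \<in> inc G A \<inter> inc G (E - A) \<inter> inc G X"
  using assms unfolding bd_def inc_def by blast

lemma shore_Diff:
  assumes A: "A \<subseteq> E"
  shows "shore G D \<C> A - Y \<subseteq> stray A"
proof
  fix v assume v: "v \<in> shore G D \<C> A - Y"
  then obtain X where X: "X = D \<or> X \<in> \<C>" "v \<in> bd G (X \<inter> A)" by (auto simp: shore_def)
  have XD: "X \<subseteq> D" using X(1) \<C> by auto
  have "bd G X \<subseteq> Y" using X(1) XD D by (auto simp: shore_def Int_absorb2)
  then have "v \<in> inc G A \<inter> inc G (E - A) \<inter> inc G X"
    using bd_Int_subset[OF A _ X(2)] XD D v by auto
  then show "v \<in> stray A" using inc_mono[OF XD, of G] v by (auto simp: stray_def)
qed

text \<open>A stray vertex is not in \<open>bd G D\<close>, so all its edges lie in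
  \<open>D\<close>; moving \<open>D\<close> into \<open>A\<close> therefore removes it from the cut
  set.\<close>

lemma stray_subset:
  assumes A: "A \<subseteq> E"
  shows "stray A \<subseteq> cut_set G Z1 Z2 A - cut_set G Z1 Z2 (A \<union> D)"
proof
  fix v assume v: "v \<in> stray A"
  then have *: "v \<notin> inc G (E - D)" using bd_D by (auto simp: stray_def bd_def)
  then have "v \<notin> Z2" using Z v by (auto simp: stray_def)
  moreover have "v \<notin> inc G (E - (A \<union> D))" using * inc_mono[of "E - (A \<union> D)" "E - D" G] by auto
  ultimately show "v \<in> cut_set G Z1 Z2 A - cut_set G Z1 Z2 (A \<union> D)" using v by (auto simp: stray_def cut_set_def)
qed

text \<open>A vertex entering the cut set meets \<open>D\<close> but not \<open>A\<close>. It also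
  meets an edge outside \<open>D\<close>, either directly or, if it is in \<open>Z2\<close>, by the
  hypothesis on \<open>Z2\<close>.\<close>

lemma cut_set_Diff:
  assumes A: "A \<subseteq> E"
  shows "cut_set G Z1 Z2 (A \<union> D) - cut_set G Z1 Z2 A \<subseteq> bd G D - inc G A"
proof
  fix v assume v: "v \<in> cut_set G Z1 Z2 (A \<union> D) - cut_set G Z1 Z2 A"
  have m: "inc G (E - (A \<union> D)) \<subseteq> inc G (E - A)" "inc G (E - (A \<union> D)) \<subseteq> inc G (E - D)"
    by (auto intro!: inc_mono)
  then have "v \<notin> inc G A \<union> Z1" "v \<in> inc G D" using v by (auto simp: cut_set_def inc_Un)
  moreover have "v \<in> inc G (E - D)" using v m Z \<open>v \<in> inc G D\<close> by (auto simp: cut_set_def)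
  ultimately show "v \<in> bd G D - inc G A" by (auto simp: bd_def)
qed

lemma shore_avoid:
  assumes A: "A \<subseteq> E"
  shows "Y - inc G (A \<inter> D) \<subseteq> Y - shore G D \<C> A"
  using shore_subset[OF A] by auto

lemma cut_set_Diff_Y:
  assumes A: "A \<subseteq> E"
  shows "cut_set G Z1 Z2 (A \<union> D) - cut_set G Z1 Z2 A \<subseteq> Y - inc G (A \<inter> D)"
  using cut_set_Diff[OF A] bd_D inc_mono[of "A \<inter> D" A G] by auto

text \<open>Vertices gained by the bag are stray, stray vertices leave the cut set, at least as many
  must enter it since \<open>A\<close> is no worse than \<open>A \<union> D\<close>, and those that
  enter are lost from the bag. The inequalities are stated separately because
  \<open>shore_eq\<close> uses equality in individual ones.\<close>

lemma card_chain:
  assumes A: "A \<subseteq> E" and le: "card (cut_set G Z1 Z2 A) \<le> card (cut_set G Z1 Z2 (A \<union> D))"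
  shows "card (shore G D \<C> A - Y) \<le> card (stray A)"
    and "card (stray A) \<le> card (cut_set G Z1 Z2 A - cut_set G Z1 Z2 (A \<union> D))"
    and "card (cut_set G Z1 Z2 A - cut_set G Z1 Z2 (A \<union> D)) \<le> card (cut_set G Z1 Z2 (A \<union> D) - cut_set G Z1 Z2 A)"
    and "card (cut_set G Z1 Z2 (A \<union> D) - cut_set G Z1 Z2 A) \<le> card (Y - inc G (A \<inter> D))"
    and "card (Y - inc G (A \<inter> D)) \<le> card (Y - shore G D \<C> A)"
proof -
  have fc: "finite (cut_set G Z1 Z2 A)" "finite (cut_set G Z1 Z2 (A \<union> D))"
    using A D by (auto intro!: finite_cut_set G finZ)
  have fY: "finite Y" by (rule finite_shore) simp
  show "card (stray A) \<le> card (cut_set G Z1 Z2 A - cut_set G Z1 Z2 (A \<union> D))"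
    using stray_subset[OF A] fc by (intro card_mono) auto
  have "finite (stray A)" using stray_subset[OF A] fc finite_subset by blast
  then show "card (shore G D \<C> A - Y) \<le> card (stray A)"
    using shore_Diff[OF A] by (intro card_mono)
  show "card (cut_set G Z1 Z2 A - cut_set G Z1 Z2 (A \<union> D)) \<le> card (cut_set G Z1 Z2 (A \<union> D) - cut_set G Z1 Z2 A)"
    using card_Diff_le_iff(1)[OF fc] le by simp
  show "card (cut_set G Z1 Z2 (A \<union> D) - cut_set G Z1 Z2 A) \<le> card (Y - inc G (A \<inter> D))"
    using cut_set_Diff_Y[OF A] fY by (intro card_mono) auto
  show "card (Y - inc G (A \<inter> D)) \<le> card (Y - shore G D \<C> A)"
    using shore_avoid[OF A] fY by (intro card_mono) auto
qed

lemma card_shore_le: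
  assumes A: "A \<subseteq> E" and le: "card (cut_set G Z1 Z2 A) \<le> card (cut_set G Z1 Z2 (A \<union> D))"
  shows "card (shore G D \<C> A) \<le> card Y"
  using card_chain[OF A le] card_Diff_le_iff(1)[OF finite_shore[OF A] finite_shore[OF order_refl]]
  by linarith

text \<open>If the bag keeps its size, the chain is tight, and passing to
  \<open>A \<union> D\<close> exchanges the stray vertices for equally many vertices of smaller
  weight \<open>h\<close>. Minimality of the total weight excludes this unless there are none; then
  all of \<open>Y\<close> meets \<open>A\<close>, and the other copy gains nothing.\<close>

lemma shore_eq:
  fixes h :: "'v \<Rightarrow> nat"
  assumes A: "A \<subseteq> E" and le: "card (cut_set G Z1 Z2 A) \<le> card (cut_set G Z1 Z2 (A \<union> D))"
    and sum_le: "card (cut_set G Z1 Z2 (A \<union> D)) = card (cut_set G Z1 Z2 A) \<Longrightarrow>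
      sum h (cut_set G Z1 Z2 A) \<le> sum h (cut_set G Z1 Z2 (A \<union> D))"
    and h: "\<And>v w. v \<in> bd G D \<Longrightarrow> w \<in> inc G D - Y \<Longrightarrow> h v < h w"
    and eq: "card (shore G D \<C> A) = card Y"
  shows "shore G D \<C> (E - A) \<subseteq> inc G A \<inter> inc G (E - A)"
proof -
  let ?S = "cut_set G Z1 Z2 A" and ?S' = "cut_set G Z1 Z2 (A \<union> D)"
  have fS: "finite ?S" "finite ?S'" using A D by (auto intro!: finite_cut_set G finZ)
  have fY: "finite Y" by (rule finite_shore) simp
  have "card (shore G D \<C> A - Y) = card (Y - shore G D \<C> A)"
    using card_Diff_le_iff(2)[OF finite_shore[OF A] finite_shore[OF order_refl]] eq by simp
  then have c: "card (stray A) = card (?S - ?S')" "card (?S - ?S') = card (?S' - ?S)"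
    "card (?S' - ?S) = card (Y - inc G (A \<inter> D))"
    using card_chain[OF A le] by linarith+
  have R: "stray A = ?S - ?S'"
    using stray_subset[OF A] c(1) fS by (intro card_subset_eq) auto
  have X: "?S' - ?S = Y - inc G (A \<inter> D)"
    using cut_set_Diff_Y[OF A] c(3) fY by (intro card_subset_eq) auto
  have "card ?S' = card ?S" using card_Diff_le_iff(2)[OF fS] c(2) by simp
  then have "sum h ?S \<le> sum h ?S'" by (rule sum_le)
  moreover have "sum h ?S = sum h (?S - ?S') + sum h (?S \<inter> ?S')" "sum h ?S' = sum h (?S' - ?S) + sum h (?S \<inter> ?S')"
    using sum.Int_Diff[OF fS(1), of h ?S'] sum.Int_Diff[OF fS(2), of h ?S] by (simp_all add: Int_commute)
  ultimately have sle: "sum h (?S - ?S') \<le> sum h (?S' - ?S)" by simp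
  have stray0: "stray A = {}"
  proof (rule ccontr)
    assume ne: "stray A \<noteq> {}"
    obtain f where f: "bij_betw f (?S - ?S') (?S' - ?S)"
      using finite_same_card_bij[of "?S - ?S'" "?S' - ?S"] fS c(2) by auto
    have "sum h (?S' - ?S) = (\<Sum>w\<in>?S - ?S'. h (f w))"
      using sum.reindex_bij_betw[OF f] by metis
    also have "\<dots> < sum h (?S - ?S')"
    proof (rule sum_strict_mono)
      fix w assume w: "w \<in> ?S - ?S'"
      then have "f w \<in> bd G D" using f cut_set_Diff[OF A] by (auto simp: bij_betw_def)
      moreover have "w \<in> inc G D - Y" using w R by (auto simp: stray_def)
      ultimately show "h (f w) < h w" by (rule h)
    qed (use fS ne R in auto)
    finally show False using sle by simp
  qed
  \<comment> \<open>By tightness this set has as many elements as \<open>stray A\<close>, namely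
    none.\<close>
  have "Y - inc G (A \<inter> D) = {}" using R X c stray0 fY by auto
  then have YA: "Y \<subseteq> inc G A" using inc_mono[of "A \<inter> D" A G] by auto
  have "stray (E - A) = {}" using stray0 A by (auto simp: stray_def double_diff)
  then have "shore G D \<C> (E - A) \<subseteq> Y" using shore_Diff[of "E - A"] by auto
  moreover have "shore G D \<C> (E - A) \<subseteq> inc G (E - A)"
    using shore_subset[of "E - A"] inc_mono[of "(E - A) \<inter> D" "E - A" G] by auto
  ultimately show ?thesis using YA by auto
qed

end

section \<open>The doubled tree\<close>

lemma image_mset_pair_cong:
  assumes "finite S" "\<And>s. s \<in> S \<Longrightarrow> {#a s, b s#} = {#c s, d s#}"
  shows "image_mset a (mset_set S) + image_mset b (mset_set S) =
    image_mset c (mset_set S) + image_mset d (mset_set S)"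
  using assms
proof (induction S rule: finite_induct)
  case (insert x S)
  have "{#a x#} + {#b x#} = {#c x#} + {#d x#}" using insert.prems[of x] by (simp add: add_mset_commute)
  moreover have "image_mset a (mset_set S) + image_mset b (mset_set S) =
    image_mset c (mset_set S) + image_mset d (mset_set S)" using insert by auto
  ultimately have "({#a x#} + {#b x#}) + (image_mset a (mset_set S) + image_mset b (mset_set S)) =
    ({#c x#} + {#d x#}) + (image_mset c (mset_set S) + image_mset d (mset_set S))" by simp
  then show ?case using insert.hyps by (simp add: ac_simps)
qed simp

text \<open>Here \<open>a\<close> and \<open>b\<close> are the bag sizes of the two copies and
  \<open>y\<close> the old ones. If one copy of a node keeps its size, that value cancels against
  the old one and the other copy is dominated by \<open>y t\<close>; at all other nodes both new
  values are below the old one.\<close>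

lemma mult_less_than_doubling:
  fixes y a b :: "'n \<Rightarrow> nat"
  assumes N: "finite N" "t \<in> N"
    and t: "a t < y t" "b t < y t"
    and le: "\<And>s. s \<in> N - {t} \<Longrightarrow> a s \<le> y s" "\<And>s. s \<in> N - {t} \<Longrightarrow> b s \<le> y s"
    and eq: "\<And>s. s \<in> N - {t} \<Longrightarrow> a s = y s \<Longrightarrow> b s < y t"
      "\<And>s. s \<in> N - {t} \<Longrightarrow> b s = y s \<Longrightarrow> a s < y t"
  shows "(image_mset a (mset_set N) + image_mset b (mset_set N), image_mset y (mset_set N)) \<in> mult less_than"
proof -
  \<comment> \<open>\<open>K\<close> collects the nodes with a cancelling copy, and \<open>z\<close>
    is the size of the other copy. As \<open>t\<close> is not in \<open>K\<close>, the value
    \<open>y t\<close> stays available as a dominating element.\<close>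
  define K where "K = {s \<in> N - {t}. a s = y s \<or> b s = y s}"
  define z where "z s = (if a s = y s then b s else a s)" for s
  have fin: "finite K" "finite (N - K)" and sub: "K \<subseteq> N" using N by (auto simp: K_def)
  have split: "mset_set N = mset_set K + mset_set (N - K)"
    using mset_set_Union[OF fin] sub by (simp add: Un_absorb1)
  let ?I = "image_mset y (mset_set K)" and ?J = "image_mset y (mset_set (N - K))"
  let ?K = "image_mset z (mset_set K) + image_mset a (mset_set (N - K)) + image_mset b (mset_set (N - K))"
  have "image_mset a (mset_set K) + image_mset b (mset_set K) = ?I + image_mset z (mset_set K)"
    using fin(1) by (rule image_mset_pair_cong) (auto simp: K_def z_def add_mset_commute)
  then have "image_mset a (mset_set N) + image_mset b (mset_set N) = ?I + ?K"
    unfolding split by (simp add: ac_simps)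
  moreover have "image_mset y (mset_set N) = ?I + ?J" unfolding split by simp
  moreover have "(?I + ?K, ?I + ?J) \<in> mult less_than"
  proof (rule one_step_implies_mult)
    have tK: "t \<in> N - K" using N by (auto simp: K_def)
    then show "?J \<noteq> {#}" using fin(2) by (auto simp: mset_set_empty_iff)
    show "\<forall>k\<in>set_mset ?K. \<exists>j\<in>set_mset ?J. (k, j) \<in> less_than"
    proof
      fix k assume "k \<in> set_mset ?K"
      then consider s where "s \<in> K" "k = z s" | s where "s \<in> N - K" "k = a s \<or> k = b s"
        using fin by auto
      then show "\<exists>j\<in>set_mset ?J. (k, j) \<in> less_than"
      proof cases
        case 1
        then have "k < y t" using eq[of s] by (auto simp: K_def z_def)
        then show ?thesis using tK fin by auto
      next
        case 2
        then have "k < y s" using t le[of s] by (cases "s = t") (auto simp: K_def order_less_le)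
        then show ?thesis using 2(1) fin by auto
      qed
    qed
  qed
  ultimately show ?thesis by simp
qed

section \<open>Decompositions rooted at a node carrying no edge, and heights of vertices\<close>

locale rooted_decomposition = rooted N r p
  for N :: "'n set" and r p +
  fixes G :: "('v, 'e) mgraph" and leaf :: "'e \<Rightarrow> 'n"
  assumes G: "fin_mgraph G"
    and leaf_in: "leaf ` edges G \<subseteq> N" and inj_leaf: "inj_on leaf (edges G)"
    and leaf_neq_root: "e \<in> edges G \<Longrightarrow> leaf e \<noteq> r"
    and leaf_no_child: "e \<in> edges G \<Longrightarrow> x \<in> N \<Longrightarrow> p x \<noteq> leaf e"
begin

abbreviation "E \<equiv> edges G"
abbreviation "D \<equiv> below G leaf p"
abbreviation "bag \<equiv> rbag G leaf N r p"
abbreviation "children s \<equiv> {c \<in> N - {r}. p c = s}"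

text \<open>The bag of the copy of \<open>s\<close> that keeps the edges of \<open>A\<close>, not
  counting the link between the two roots.\<close>

definition half :: "'e set \<Rightarrow> 'n \<Rightarrow> 'v set" where
  "half A s = inc G {e \<in> A. leaf e = s} \<union> (\<Union>c\<in>{c \<in> N - {r}. c = s \<or> p c = s}. bd G (D c \<inter> A))"

lemma bag_root: "bag r = (\<Union>c\<in>children r. bd G (D c))"
proof -
  have "{e \<in> E. leaf e = r} = {}" "{c \<in> N - {r}. c = r \<or> p c = r} = children r"
    using leaf_neq_root by auto
  then show ?thesis unfolding rbag_def by (simp only: inc_empty Un_empty_left)
qed

lemma child_towards:
  assumes "x \<in> N" "x \<in> desc p s" "x \<noteq> s"
  obtains c where "c \<in> children s" "x \<in> desc p c"
proof -
  obtain n where n: "p ((p ^^ n) x) = s" "(p ^^ n) x \<noteq> s" using desc_child[OF assms(2,3)] by blast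
  then have "(p ^^ n) x \<noteq> r" by (metis parent_root)
  then have "(p ^^ n) x \<in> children s" using funpow_in[OF assms(1)] n by blast
  moreover have "x \<in> desc p ((p ^^ n) x)" by (auto simp: desc_def)
  ultimately show ?thesis by (rule that)
qed

lemma below_disjoint:
  assumes "s \<notin> desc p t" "t \<notin> desc p s"
  shows "D s \<subseteq> E - D t"
  using assms desc_linear[of _ p s t] by (auto simp: below_def)

lemma siblings_below_disjoint:
  assumes "c \<in> children s" "c' \<in> children s" "c \<noteq> c'"
  shows "D c \<subseteq> E - D c'"
proof
  fix e assume e: "e \<in> D c"
  then have "leaf e \<in> N" "leaf e \<in> desc p c" "e \<in> E" using leaf_in by (auto simp: below_def)
  then show "e \<in> E - D c'"
    using siblings_disjoint[of c c' "leaf e"] assms by (auto simp: below_def)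
qed

text \<open>A vertex of the root bag is in the boundary of \<open>D c\<close> for some child
  \<open>c\<close> of the root. If \<open>s\<close> is below \<open>c\<close>, its edges outside
  \<open>D c\<close> are outside \<open>D s\<close>; otherwise its edges in \<open>D c\<close>
  are.\<close>

lemma bag_root_meets_outside:
  assumes s: "s \<in> N" "s \<noteq> r"
  shows "bag r \<inter> inc G (D s) \<subseteq> inc G (E - D s)"
proof
  fix v assume v: "v \<in> bag r \<inter> inc G (D s)"
  then obtain c where c: "c \<in> children r" "v \<in> bd G (D c)" by (auto simp: bag_root)
  obtain c' where c': "c' \<in> children r" "s \<in> desc p c'"
    using child_towards[OF s(1) below_root[OF s(1)] s(2)] .
  have sub: "D s \<subseteq> D c'" using c'(2) by (rule below_mono)
  show "v \<in> inc G (E - D s)"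
  proof (cases "c = c'")
    case True
    then show ?thesis using c(2) sub inc_mono[of "E - D c'" "E - D s" G] by (auto simp: bd_def)
  next
    case False
    then have "D c \<subseteq> E - D s" using siblings_below_disjoint[OF c(1) c'(1)] sub by auto
    then show ?thesis using c(2) inc_mono[of "D c" "E - D s" G] by (auto simp: bd_def)
  qed
qed

text \<open>The distance of \<open>v\<close> from the root: the number of non-root nodes strictly above the subtree of \<open>v\<close>.\<close>

definition height :: "'v \<Rightarrow> nat" where
  "height v = card {s \<in> N - {r}. v \<in> inc G (D s) - bag s}"

lemma bd_subset_bag: "s \<in> N - {r} \<Longrightarrow> bd G (D s) \<subseteq> bag s"
  by (auto simp: rbag_def)

text \<open>A node \<open>s'\<close> counted for \<open>v\<close> has all edges at \<open>v\<close>
  below it; as \<open>v\<close> has edges both in and outside \<open>D s\<close>, this forces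
  \<open>s'\<close> to be a proper ancestor of \<open>s\<close>. All edges at \<open>w\<close> lie
  below \<open>s\<close>, hence below one child of \<open>s'\<close>, so \<open>s'\<close> is
  counted for \<open>w\<close> too. The node \<open>s\<close> is counted for \<open>w\<close>
  only.\<close>

lemma height_less:
  assumes s: "s \<in> N" "s \<noteq> r" and v: "v \<in> bd G (D s)" and w: "w \<in> inc G (D s) - bag s"
  shows "height v < height w"
  unfolding height_def
proof (rule psubset_card_mono)
  show "finite {s \<in> N - {r}. w \<in> inc G (D s) - bag s}" using finite_nodes by simp
  have sub: "w \<in> inc G (D s') - bag s'" if s': "s' \<in> N" "s' \<noteq> r" "v \<in> inc G (D s') - bag s'" for s'
  proof -
    have v': "v \<notin> inc G (E - D s')" using s' bd_subset_bag[of s'] by (auto simp: bd_def)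
    have "s' \<notin> desc p s"
    proof
      assume "s' \<in> desc p s"
      then have "E - D s \<subseteq> E - D s'" using below_mono[of s' p s G leaf] by auto
      then show False using v v' inc_mono[of "E - D s" "E - D s'" G] by (auto simp: bd_def)
    qed
    moreover have "s \<in> desc p s'"
    proof (rule ccontr)
      assume "s \<notin> desc p s'"
      then have "D s \<subseteq> E - D s'" using \<open>s' \<notin> desc p s\<close> by (intro below_disjoint)
      then show False using v v' inc_mono[of "D s" "E - D s'" G] by (auto simp: bd_def)
    qed
    ultimately have "s \<noteq> s'" by auto
    then obtain c where c: "c \<in> children s'" "s \<in> desc p c"
      using child_towards[OF s(1) \<open>s \<in> desc p s'\<close>] by blast
    have Ds: "D s \<subseteq> D c" "D s \<subseteq> D s'" using c(2) \<open>s \<in> desc p s'\<close> below_mono by metis+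
    have w': "w \<notin> inc G (E - D s)" using w bd_subset_bag[of s] s by (auto simp: bd_def)
    \<comment> \<open>\<open>D s'\<close> and \<open>D c\<close> contain \<open>D s\<close>, and the
      sets of the other children of \<open>s'\<close> are disjoint from it, so no link at
      \<open>s'\<close> divides the edges at \<open>w\<close>.\<close>
    have out: "w \<notin> bd G (D x)" if "x \<in> N - {r}" "x = s' \<or> p x = s'" for x
    proof (cases "x = s' \<or> x = c")
      case True
      then have "E - D x \<subseteq> E - D s" using Ds by auto
      then show ?thesis using w' inc_mono[of "E - D x" "E - D s" G] by (auto simp: bd_def)
    next
      case False
      then have "D x \<subseteq> E - D s" using siblings_below_disjoint[of x s' c] that c Ds by auto
      then show ?thesis using w' inc_mono[of "D x" "E - D s" G] by (auto simp: bd_def)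
    qed
    have "{e \<in> E. leaf e = s'} = {}" using leaf_no_child[of _ c] c(1) by fastforce
    then have "w \<notin> bag s'" unfolding rbag_def using out by (simp only: inc_empty Un_empty_left) blast
    then show ?thesis using w Ds(2) inc_mono[of "D s" "D s'" G] by auto
  qed
  moreover have "s \<in> {s \<in> N - {r}. w \<in> inc G (D s) - bag s}" using s w by auto
  moreover have "v \<in> bag s" using v bd_subset_bag[of s] s by auto
  ultimately show "{s \<in> N - {r}. v \<in> inc G (D s) - bag s} \<subset> {s \<in> N - {r}. w \<in> inc G (D s) - bag s}"
    by auto
qed

lemma half_internal:
  assumes s: "s \<in> N" "s \<noteq> r" "s \<notin> leaf ` E" and A: "A \<subseteq> E"
  shows "half A s = shore G (D s) (D ` children s) A"
proof -
  have "{e \<in> A. leaf e = s} = {}" using s(3) A by auto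
  moreover have "{c \<in> N - {r}. c = s \<or> p c = s} = insert s (children s)" using s by auto
  ultimately show ?thesis unfolding half_def shore_def by (simp only: inc_empty) simp
qed

lemma half_edges: "half E s = bag s"
  by (simp add: half_def rbag_def Int_absorb2 below_subset)

text \<open>Only \<open>e\<close> lies below its leaf, so intersecting with \<open>A\<close> leaves
  everything or nothing: the twin of the leaf has an empty bag.\<close>

lemma half_leaf:
  assumes e: "e \<in> E" and A: "A \<subseteq> E"
  shows "half A (leaf e) = (if e \<in> A then ends G e else {})"
proof -
  have c: "{c \<in> N - {r}. c = leaf e \<or> p c = leaf e} = {leaf e}"
    using e leaf_in leaf_neq_root leaf_no_child by auto
  have "f = e" if f: "f \<in> E" "leaf f \<in> desc p (leaf e)" for f
  proof (rule ccontr)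
    assume "f \<noteq> e"
    then have "leaf f \<noteq> leaf e" using inj_leaf e f by (auto simp: inj_on_eq_iff)
    then obtain c where "c \<in> children (leaf e)" using child_towards[OF _ f(2)] leaf_in f(1) by blast
    then show False using leaf_no_child e by auto
  qed
  then have "D (leaf e) = {e}" using e by (auto simp: below_def)
  moreover have "{f \<in> A. leaf f = leaf e} = {e} \<inter> A" using inj_leaf e A by (auto simp: inj_on_def)
  ultimately show ?thesis unfolding half_def c by (auto simp: bd_def inc_def)
qed

text \<open>The copy tagged \<open>True\<close> keeps \<open>A\<close> and contains the root of the
  doubled tree; \<open>(r, False)\<close> hangs below \<open>(r, True)\<close>, which is its own
  parent.\<close>

definition dpar :: "'n \<times> bool \<Rightarrow> 'n \<times> bool" where
  "dpar x = (if fst x = r then (r, True) else (p (fst x), snd x))"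

definition dleaf :: "'e set \<Rightarrow> 'e \<Rightarrow> 'n \<times> bool" where
  "dleaf A e = (leaf e, e \<in> A)"

definition side :: "'e set \<Rightarrow> bool \<Rightarrow> 'e set" where
  "side A b = (if b then A else E - A)"

lemma desc_root_copy: "(r, True) \<in> desc dpar t \<longleftrightarrow> t = (r, True)"
proof -
  have "(dpar ^^ n) (r, True) = (r, True)" for n by (induction n) (auto simp: dpar_def)
  then show ?thesis by (auto simp: desc_def)
qed

lemma desc_dpar:
  assumes "x \<in> N" "s \<noteq> r"
  shows "(x, b) \<in> desc dpar (s, b') \<longleftrightarrow> b = b' \<and> x \<in> desc p s"
  using assms(1)
proof (induction "depth x" arbitrary: x)
  case 0
  then have "x = r" using depth_parent by (cases "x = r") auto
  then show ?case using assms(2) desc_root_copy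
    by (subst desc_step) (auto simp: dpar_def root_desc_iff)
next
  case (Suc n)
  show ?case
  proof (cases "x = r")
    case True
    then show ?thesis using assms(2) desc_root_copy
      by (subst desc_step) (auto simp: dpar_def root_desc_iff)
  next
    case False
    then have "(p x, b) \<in> desc dpar (s, b') \<longleftrightarrow> b = b' \<and> p x \<in> desc p s"
      using Suc depth_parent[of x] parent_in by auto
    then show ?thesis
      using desc_step[of "(x, b)" dpar "(s, b')"] desc_step[of x p s] False by (auto simp: dpar_def)
  qed
qed

lemma desc_dpar_roots:
  assumes "x \<in> N"
  shows "(x, b) \<in> desc dpar (r, b)" "(x, b) \<in> desc dpar (r, False) \<longleftrightarrow> \<not> b"
    "(x, b) \<in> desc dpar (r, True)"
proof -
  show top: "(x, b) \<in> desc dpar (r, b)" for b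
    using assms
  proof (induction "depth x" arbitrary: x)
    case 0
    then have "x = r" using depth_parent by (cases "x = r") auto
    then show ?case by simp
  next
    case (Suc n)
    show ?case
    proof (cases "x = r")
      case False
      then have "(p x, b) \<in> desc dpar (r, b)" using Suc depth_parent[of x] parent_in by auto
      then show ?thesis using False by (subst desc_step) (auto simp: dpar_def)
    qed simp
  qed
  have "(r, False) \<in> desc dpar (r, True)" by (subst desc_step) (auto simp: dpar_def)
  then show "(x, b) \<in> desc dpar (r, True)"
    using top[of b] desc_trans by (cases b) auto
  have "(x, True) \<notin> desc dpar (r, False)"
  proof
    assume "(x, True) \<in> desc dpar (r, False)"
    then obtain n where n: "(dpar ^^ n) (x, True) = (r, False)" by (auto simp: desc_def)
    have "snd ((dpar ^^ n) (x, True))" for n by (induction n) (auto simp: dpar_def)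
    then show False using n by (metis snd_conv)
  qed
  then show "(x, b) \<in> desc dpar (r, False) \<longleftrightarrow> \<not> b" using top[of False] by (cases b) auto
qed

lemma rooted_double: "rooted (N \<times> UNIV) (r, True) dpar"
  using finite_nodes root_in parent_in desc_dpar_roots(3)
  by unfold_locales (auto simp: dpar_def)

text \<open>Below a copy of a node other than \<open>r\<close> only one tag occurs, and below
  \<open>(r, False)\<close> lies exactly the second copy; thus the joining link has adhesion set
  \<open>bd G A\<close>.\<close>

lemma below_double:
  assumes "A \<subseteq> E"
  shows "s \<noteq> r \<Longrightarrow> below G (dleaf A) dpar (s, b) = D s \<inter> side A b"
    and "below G (dleaf A) dpar (r, False) = E - A"
proof -
  have leaf: "leaf e \<in> N" if "e \<in> E" for e using leaf_in that by auto
  show "below G (dleaf A) dpar (s, b) = D s \<inter> side A b" if "s \<noteq> r"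
    using assms by (auto simp: below_def dleaf_def side_def desc_dpar[OF leaf that])
  show "below G (dleaf A) dpar (r, False) = E - A"
    by (auto simp: below_def dleaf_def desc_dpar_roots(2)[OF leaf])
qed

text \<open>The joining link is the parent link of \<open>(r, False)\<close> and a child link of
  \<open>(r, True)\<close>, so it contributes to these two bags only.\<close>

lemma bag_double:
  assumes A: "A \<subseteq> E" and s: "s \<in> N"
  shows "rbag G (dleaf A) (N \<times> UNIV) (r, True) dpar (s, b) =
    half (side A b) s \<union> (if s = r then bd G A else {})"
proof -
  let ?I = "{c \<in> N \<times> UNIV - {(r, True)}. c = (s, b) \<or> dpar c = (s, b)}"
  let ?J = "{c \<in> N - {r}. c = s \<or> p c = s}"
  have I: "?I = (\<lambda>c. (c, b)) ` ?J \<union> (if s = r then {(r, False)} else {})"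
    using root_in s by (auto simp: dpar_def split: if_splits)
  have l: "{e \<in> E. dleaf A e = (s, b)} = {e \<in> side A b. leaf e = s}"
    using A by (auto simp: dleaf_def side_def)
  have "(\<Union>c\<in>(\<lambda>c. (c, b)) ` ?J. bd G (below G (dleaf A) dpar c)) = (\<Union>c\<in>?J. bd G (D c \<inter> side A b))"
    by (auto simp: below_double(1)[OF A])
  moreover have "bd G (below G (dleaf A) dpar (r, False)) = bd G A"
    using below_double(2)[OF A] bd_Diff[OF A] by simp
  ultimately show ?thesis unfolding rbag_def half_def I l by auto
qed

section \<open>The optimal bipartition and the bounds it yields\<close>

lemma optimal_cut:
  obtains A where "A \<subseteq> E" "\<And>A'. A' \<subseteq> E \<Longrightarrow> card (cut_set G Z1 Z2 A) \<le> card (cut_set G Z1 Z2 A')"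
    "\<And>A'. A' \<subseteq> E \<Longrightarrow> card (cut_set G Z1 Z2 A') = card (cut_set G Z1 Z2 A) \<Longrightarrow>
      sum height (cut_set G Z1 Z2 A) \<le> sum height (cut_set G Z1 Z2 A')"
proof -
  let ?c = "\<lambda>A. card (cut_set G Z1 Z2 A)"
  \<comment> \<open>The minimisation is lexicographic: first the size of the cut set, then the sum
    of heights among the sets attaining it.\<close>
  obtain A0 where A0: "A0 \<subseteq> E" "\<And>A'. A' \<subseteq> E \<Longrightarrow> ?c A0 \<le> ?c A'"
    using ex_has_least_nat[of "\<lambda>A. A \<subseteq> E" E ?c] by auto
  obtain A where A: "A \<subseteq> E" "?c A = ?c A0"
    "\<And>A'. A' \<subseteq> E \<Longrightarrow> ?c A' = ?c A0 \<Longrightarrow> sum height (cut_set G Z1 Z2 A) \<le> sum height (cut_set G Z1 Z2 A')"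
    using ex_has_least_nat[of "\<lambda>A. A \<subseteq> E \<and> ?c A = ?c A0" A0 "\<lambda>A. sum height (cut_set G Z1 Z2 A)"] A0(1)
    by auto
  show ?thesis by (rule that[of A]) (use A A0 in auto)
qed

text \<open>The set \<open>C\<close> is left free because two choices are needed: no children for
  adhesion sets, all children for bags.\<close>

lemma uncrossing_below:
  assumes "Z1 \<subseteq> bag r" "Z2 \<subseteq> bag r" "s \<in> N" "s \<noteq> r" "C \<subseteq> children s"
  shows "uncrossing G Z1 Z2 (D s) (D ` C)"
proof
  show "finite Z1" "finite Z2"
    by (rule finite_subset[OF assms(1) finite_rbag[OF G]], rule finite_subset[OF assms(2) finite_rbag[OF G]])
  show "X \<subseteq> D s" if X: "X \<in> D ` C" for X
  proof -
    obtain c where "X = D c" "p c = s" using X assms(5) by auto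
    then show ?thesis using below_mono[OF desc_parent[of c p]] by simp
  qed
  show "(Z1 \<union> Z2) \<inter> inc G (D s) \<subseteq> inc G (E - D s)"
    using bag_root_meets_outside[OF assms(3,4)] assms(1,2) by blast
qed (rule G, rule below_subset)

text \<open>Optimality of \<open>A\<close> against the competitor \<open>A \<union> D s\<close>
  yields the first two bounds by counting. For the third, \<open>shore_eq\<close> puts the bag of
  the twin into \<open>inc G A \<inter> inc G (E - A)\<close>, a part of the cut set. Bags of leaves
  are handled directly.\<close>

lemma half_bounds:
  assumes Z: "Z1 \<subseteq> bag r" "Z2 \<subseteq> bag r" and A: "A \<subseteq> E"
    and min: "\<And>A'. A' \<subseteq> E \<Longrightarrow> card (cut_set G Z1 Z2 A) \<le> card (cut_set G Z1 Z2 A')"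
    and sum: "\<And>A'. A' \<subseteq> E \<Longrightarrow> card (cut_set G Z1 Z2 A') = card (cut_set G Z1 Z2 A) \<Longrightarrow>
      sum height (cut_set G Z1 Z2 A) \<le> sum height (cut_set G Z1 Z2 A')"
    and s: "s \<in> N" "s \<noteq> r"
  shows "card (bd G (D s \<inter> A)) \<le> card (bd G (D s))"
    and "card (half A s) \<le> card (bag s)"
    and "card (half A s) = card (bag s) \<Longrightarrow> card (half (E - A) s) \<le> card (cut_set G Z1 Z2 A)"
proof -
  have AD: "A \<union> D s \<subseteq> E" using A below_subset[of G leaf p s] by blast
  have le: "card (cut_set G Z1 Z2 A) \<le> card (cut_set G Z1 Z2 (A \<union> D s))" by (rule min[OF AD])
  interpret U0: uncrossing G Z1 Z2 "D s" "{}" using uncrossing_below[OF Z s, of "{}"] by simp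
  show "card (bd G (D s \<inter> A)) \<le> card (bd G (D s))"
    using U0.card_shore_le[OF A le] by (simp add: shore_def Int_absorb2 below_subset)
  interpret U: uncrossing G Z1 Z2 "D s" "D ` children s" by (rule uncrossing_below[OF Z s order_refl])
  have fc: "finite (cut_set G Z1 Z2 A)" using finite_cut_set[OF G U.finZ A] .
  show "card (half A s) \<le> card (bag s)"
  proof (cases "s \<in> leaf ` E")
    case True
    then obtain e where e: "e \<in> E" "s = leaf e" by auto
    then have "bag s = ends G e" using half_leaf[OF e(1) order_refl] half_edges by auto
    then show ?thesis using half_leaf[OF e(1) A] e by simp
  next
    case False
    then show ?thesis
      using U.card_shore_le[OF A le] half_internal[OF s False A] half_internal[OF s False order_refl]
      by (simp add: half_edges)
  qed
  show "card (half (E - A) s) \<le> card (cut_set G Z1 Z2 A)" if eq: "card (half A s) = card (bag s)"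
  proof (cases "s \<in> leaf ` E")
    case True
    then obtain e where e: "e \<in> E" "s = leaf e" by auto
    \<comment> \<open>A nonempty bag that keeps its size forces \<open>e \<in> A\<close>, so the bag
      of the twin is empty.\<close>
    have "card (ends G e) \<noteq> 0" using G e by (auto simp: fin_mgraph_def)
    moreover have "bag s = ends G e" using half_leaf[OF e(1) order_refl] e half_edges by auto
    ultimately have "e \<in> A" using eq half_leaf[OF e(1) A] e by (auto split: if_splits)
    then show ?thesis using half_leaf[OF e(1), of "E - A"] e by simp
  next
    case False
    have Y: "shore G (D s) (D ` children s) E = bag s"
      using half_internal[OF s False order_refl] by (simp add: half_edges)
    have "shore G (D s) (D ` children s) (E - A) \<subseteq> inc G A \<inter> inc G (E - A)"
    proof (rule U.shore_eq[OF A le, of height])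
      show "sum height (cut_set G Z1 Z2 A) \<le> sum height (cut_set G Z1 Z2 (A \<union> D s))"
        if "card (cut_set G Z1 Z2 (A \<union> D s)) = card (cut_set G Z1 Z2 A)" using sum[OF AD that] .
      show "height v < height w" if "v \<in> bd G (D s)" "w \<in> inc G (D s) - shore G (D s) (D ` children s) E" for v w
        using height_less[OF s] that unfolding Y by blast
      show "card (shore G (D s) (D ` children s) A) = card (shore G (D s) (D ` children s) E)"
        using eq half_internal[OF s False A] Y by simp
    qed
    then have "half (E - A) s \<subseteq> cut_set G Z1 Z2 A"
      using half_internal[OF s False, of "E - A"] by (auto simp: cut_set_def)
    then show ?thesis using fc by (rule card_mono[rotated])
  qed
qed

text \<open>A vertex of the new root bag that lies in \<open>Z2\<close> or outside the old root bag
  is in the cut set. Hence \<open>Z2\<close> is exchanged for a smaller set.\<close>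

lemma half_root:
  assumes Z: "Z1 \<subseteq> bag r" "Z2 \<subseteq> bag r" and A: "A \<subseteq> E"
    and small: "card (cut_set G Z1 Z2 A) < card Z2"
  shows "card (half A r \<union> bd G A) < card (bag r)"
proof -
  let ?U = "bag r" and ?S = "cut_set G Z1 Z2 A"
  have fU: "finite ?U" by (rule finite_rbag[OF G])
  have fZ: "finite Z1" "finite Z2" using Z fU by (auto intro: finite_subset)
  have fS: "finite ?S" using finite_cut_set[OF G fZ A] .
  have "half A r \<union> bd G A \<subseteq> (?U - Z2) \<union> ?S"
  proof
    fix v assume "v \<in> half A r \<union> bd G A"
    moreover have "{e \<in> A. leaf e = r} = {}" using A leaf_neq_root by auto
    ultimately consider "v \<in> bd G A" | c where "c \<in> children r" "v \<in> bd G (D c \<inter> A)"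
      by (auto simp: half_def)
    then show "v \<in> (?U - Z2) \<union> ?S"
    proof cases
      case 1
      then show ?thesis by (auto simp: bd_def cut_set_def)
    next
      case 2
      have vA: "v \<in> inc G A" using 2(2) inc_mono[of "D c \<inter> A" A G] by (auto simp: bd_def)
      show ?thesis
      proof (cases "v \<in> bd G (D c)")
        case True
        then have "v \<in> ?U" using 2(1) by (auto simp: bag_root)
        then show ?thesis using vA by (auto simp: cut_set_def)
      next
        case False
        then have "v \<in> inc G (E - A)" using 2(2) unfolding bd_def inc_def by blast
        then show ?thesis using vA by (auto simp: cut_set_def)
      qed
    qed
  qed
  then have "card (half A r \<union> bd G A) \<le> card ((?U - Z2) \<union> ?S)"
    using fU fS by (intro card_mono) auto
  also have "\<dots> \<le> card (?U - Z2) + card ?S" by (rule card_Un_le)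
  also have "\<dots> < card (?U - Z2) + card Z2" using small by simp
  also have "\<dots> = card ?U" using card_Diff_subset[OF fZ(2) Z(2)] card_mono[OF fU Z(2)] by simp
  finally show ?thesis .
qed

end

section \<open>The multiset measure and the improvement step\<close>

definition bag_sizes :: "('v, 'e) mgraph \<Rightarrow> ('e + nat) sgraph \<Rightarrow> nat multiset" where
  "bag_sizes G T = image_mset (\<lambda>t. card (node_bag G T t)) (mset_set (nodes T))"

lemma mset_set_times_bool:
  assumes "finite N"
  shows "mset_set (N \<times> UNIV) =
    image_mset (\<lambda>s. (s, True)) (mset_set N) + image_mset (\<lambda>s. (s, False)) (mset_set N)"
proof -
  have "N \<times> UNIV = (\<lambda>s. (s, True)) ` N \<union> (\<lambda>s. (s, False)) ` N" by (auto simp: UNIV_bool)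
  also have "mset_set \<dots> = mset_set ((\<lambda>s. (s, True)) ` N) + mset_set ((\<lambda>s. (s, False)) ` N)"
    using assms by (intro mset_set_Union) auto
  also have "\<dots> = image_mset (\<lambda>s. (s, True)) (mset_set N) + image_mset (\<lambda>s. (s, False)) (mset_set N)"
    by (subst (1 2) image_mset_mset_set) (auto simp: inj_on_def)
  finally show ?thesis .
qed

context rooted_decomposition
begin

lemma exists_better_decomposition:
  assumes Z: "Z1 \<subseteq> bag r" "Z2 \<subseteq> bag r"
    and A0: "A0 \<subseteq> E" "card (cut_set G Z1 Z2 A0) < card Z1" "card (cut_set G Z1 Z2 A0) < card Z2"
      "card (cut_set G Z1 Z2 A0) < \<theta>"
    and adh: "\<And>c. c \<in> N - {r} \<Longrightarrow> card (bd G (D c)) < \<theta>"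
  obtains T where "tree_decomposition G T" "adhesion G T < \<theta>"
    "(bag_sizes G T, image_mset (\<lambda>s. card (bag s)) (mset_set N)) \<in> mult less_than"
    "\<And>t. t \<in> nodes T \<Longrightarrow> \<exists>s\<in>N. card (node_bag G T t) \<le> card (bag s)"
proof -
  obtain A where A: "A \<subseteq> E"
    and min: "\<And>A'. A' \<subseteq> E \<Longrightarrow> card (cut_set G Z1 Z2 A) \<le> card (cut_set G Z1 Z2 A')"
    and sum: "\<And>A'. A' \<subseteq> E \<Longrightarrow> card (cut_set G Z1 Z2 A') = card (cut_set G Z1 Z2 A) \<Longrightarrow>
      sum height (cut_set G Z1 Z2 A) \<le> sum height (cut_set G Z1 Z2 A')"
    by (rule optimal_cut[of Z1 Z2]) blast
  let ?B = "E - A" and ?k = "card (cut_set G Z1 Z2 A)"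
  have B: "?B \<subseteq> E" and BB: "E - ?B = A" using A by auto
  \<comment> \<open>Exchanging \<open>Z1\<close> with \<open>Z2\<close> and \<open>A\<close> with
    \<open>E - A\<close> leaves cut sets unchanged, so \<open>E - A\<close> is optimal for the
    swapped problem and obeys the same bounds.\<close>
  have cutB: "cut_set G Z2 Z1 ?B = cut_set G Z1 Z2 A" by (rule cut_set_commute[OF A])
  have cut': "cut_set G Z2 Z1 A' = cut_set G Z1 Z2 (E - A')" if "A' \<subseteq> E" for A'
    using cut_set_commute[of "E - A'" G Z2 Z1] that by (simp add: double_diff)
  have minB: "card (cut_set G Z2 Z1 ?B) \<le> card (cut_set G Z2 Z1 A')" if "A' \<subseteq> E" for A'
    unfolding cutB cut'[OF that] by (rule min) auto
  have sumB: "sum height (cut_set G Z2 Z1 ?B) \<le> sum height (cut_set G Z2 Z1 A')"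
    if "A' \<subseteq> E" "card (cut_set G Z2 Z1 A') = card (cut_set G Z2 Z1 ?B)" for A'
    using that(2) unfolding cutB cut'[OF that(1)] by (intro sum) auto
  \<comment> \<open>\<open>A0\<close> bounds the optimal value; the bound by \<theta> controls the
    adhesion at the joining link.\<close>
  have k: "?k < card Z1" "?k < card Z2" "?k < \<theta>" using min[OF A0(1)] A0 by auto
  have boundsA: "card (bd G (D s \<inter> A)) \<le> card (bd G (D s))" "card (half A s) \<le> card (bag s)"
    "card (half A s) = card (bag s) \<Longrightarrow> card (half ?B s) \<le> ?k" if "s \<in> N" "s \<noteq> r" for s
    by (rule half_bounds[OF Z A min sum that]; assumption)+
  have boundsB: "card (bd G (D s \<inter> ?B)) \<le> card (bd G (D s))" "card (half ?B s) \<le> card (bag s)"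
    "card (half ?B s) = card (bag s) \<Longrightarrow> card (half A s) \<le> ?k" if "s \<in> N" "s \<noteq> r" for s
    by (rule half_bounds[OF Z(2,1) B minB sumB that, unfolded cutB BB]; assumption)+
  have rootA: "card (half A r \<union> bd G A) < card (bag r)" using half_root[OF Z A k(2)] .
  have rootB: "card (half ?B r \<union> bd G A) < card (bag r)"
    using half_root[OF Z(2,1) B] k(1) unfolding cutB bd_Diff[OF A] by blast
  have fU: "finite (bag r)" by (rule finite_rbag[OF G])
  have kU: "?k < card (bag r)" using k(2) card_mono[OF fU Z(2)] by simp

  let ?N = "N \<times> (UNIV :: bool set)"
  let ?b = "rbag G (dleaf A) ?N (r, True) dpar"
  have bagA: "?b (s, True) = half A s \<union> (if s = r then bd G A else {})"
    and bagB: "?b (s, False) = half ?B s \<union> (if s = r then bd G A else {})" if "s \<in> N" for s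
    using bag_double[OF A that] by (simp_all add: side_def)
  have dleaf: "dleaf A ` E \<subseteq> ?N" "inj_on (dleaf A) E"
    using leaf_in inj_leaf by (auto simp: dleaf_def inj_on_def)
  have no_child: "dleaf A e \<noteq> (r, True)" "x \<in> ?N \<Longrightarrow> dpar x \<noteq> dleaf A e" if "e \<in> E" for e x
    using leaf_neq_root[OF that] leaf_no_child[OF that] by (auto simp: dleaf_def dpar_def)
  obtain T \<phi> where T: "tree_decomposition G T" "bij_betw \<phi> ?N (nodes T)"
    and nb: "\<And>s. s \<in> ?N \<Longrightarrow> node_bag G T (\<phi> s) = ?b s"
    and ad: "\<And>\<theta>. 0 < \<theta> \<Longrightarrow> (\<And>c. c \<in> ?N - {(r, True)} \<Longrightarrow> card (bd G (below G (dleaf A) dpar c)) < \<theta>)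
      \<Longrightarrow> adhesion G T < \<theta>"
    by (rule rooted_decomposition_realized[OF rooted_double G dleaf no_child]) blast+

  have "adhesion G T < \<theta>"
  proof (rule ad)
    show "0 < \<theta>" using k(3) by simp
    fix c assume c: "c \<in> ?N - {(r, True)}"
    obtain s b where sb: "c = (s, b)" by (cases c)
    show "card (bd G (below G (dleaf A) dpar c)) < \<theta>"
    proof (cases "s = r")
      case True
      then have "below G (dleaf A) dpar c = ?B" using c sb below_double(2)[OF A] by auto
      moreover have "bd G ?B \<subseteq> cut_set G Z1 Z2 A" unfolding bd_Diff[OF A] by (auto simp: bd_def cut_set_def)
      moreover have "finite (cut_set G Z1 Z2 A)"
        by (rule finite_cut_set[OF G finite_subset[OF Z(1) fU] finite_subset[OF Z(2) fU] A])
      ultimately show ?thesis using card_mono[of "cut_set G Z1 Z2 A" "bd G ?B"] k(3) by simp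
    next
      case False
      then have s: "s \<in> N" "s \<noteq> r" using c sb by auto
      have "card (bd G (D s \<inter> side A b)) \<le> card (bd G (D s))"
        using boundsA(1)[OF s] boundsB(1)[OF s] by (cases b) (auto simp: side_def)
      then show ?thesis using adh[of s] s below_double(1)[OF A s(2)] sb by simp
    qed
  qed
  moreover have "(bag_sizes G T, image_mset (\<lambda>s. card (bag s)) (mset_set N)) \<in> mult less_than"
  proof -
    have inj: "inj_on \<phi> ?N" and im: "nodes T = \<phi> ` ?N" using T(2) by (auto simp: bij_betw_def)
    have "bag_sizes G T = image_mset (\<lambda>s. card (node_bag G T (\<phi> s))) (mset_set ?N)"
      unfolding bag_sizes_def im image_mset_mset_set[OF inj, symmetric] by (simp add: multiset.map_comp o_def)
    also have "\<dots> = image_mset (\<lambda>s. card (?b s)) (mset_set ?N)"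
      using finite_nodes by (intro image_mset_cong) (auto simp: nb)
    also have "\<dots> = image_mset (\<lambda>s. card (?b (s, True))) (mset_set N) + image_mset (\<lambda>s. card (?b (s, False))) (mset_set N)"
      unfolding mset_set_times_bool[OF finite_nodes] by (simp add: multiset.map_comp o_def)
    finally have eq: "bag_sizes G T = \<dots>" .
    show ?thesis unfolding eq
    proof (rule mult_less_than_doubling[OF finite_nodes root_in])
      show "card (?b (r, True)) < card (bag r)" "card (?b (r, False)) < card (bag r)"
        using rootA rootB bagA[OF root_in] bagB[OF root_in] by simp_all
      fix s assume s: "s \<in> N - {r}"
      then show "card (?b (s, True)) \<le> card (bag s)" "card (?b (s, False)) \<le> card (bag s)"
        using boundsA(2)[of s] boundsB(2)[of s] bagA[of s] bagB[of s] by simp_all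
      show "card (?b (s, False)) < card (bag r)" if "card (?b (s, True)) = card (bag s)"
        using boundsA(3)[of s] that s bagA[of s] bagB[of s] kU by simp
      show "card (?b (s, True)) < card (bag r)" if "card (?b (s, False)) = card (bag s)"
        using boundsB(3)[of s] that s bagA[of s] bagB[of s] kU by simp
    qed
  qed
  moreover have "\<exists>s\<in>N. card (node_bag G T t) \<le> card (bag s)" if t: "t \<in> nodes T" for t
  proof -
    obtain s b where s: "s \<in> N" "t = \<phi> (s, b)" using T(2) t unfolding bij_betw_def by blast
    then have "card (node_bag G T t) = card (?b (s, b))" using nb by simp
    also have "\<dots> \<le> card (bag s)"
    proof (cases "s = r")
      case True
      then show ?thesis using rootA rootB bagA[OF s(1)] bagB[OF s(1)] by (cases b) simp_all
    next
      case False
      then show ?thesis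
        using boundsA(2)[of s] boundsB(2)[of s] s(1) bagA[OF s(1)] bagB[OF s(1)] by (cases b) simp_all
    qed
    finally show ?thesis using s(1) by blast
  qed
  ultimately show ?thesis using that[OF T(1)] by blast
qed

end

text \<open>A bad bag cannot belong to a leaf carrying an edge, so rooting at \<open>t\<close> gives
  a \<open>rooted_decomposition\<close>. The edge set of \<open>G1\<close> in a violating separation
  is the initial small cut.\<close>

lemma improve_decomposition:
  assumes G: "fin_mgraph G" and T: "tree_decomposition G T" and adh: "adhesion G T < \<theta>"
    and t: "t \<in> nodes T" and bad: "\<not> theta_connected \<theta> G (node_bag G T t)"
  obtains T' where "tree_decomposition G T'" "adhesion G T' < \<theta>"
    "(bag_sizes G T', bag_sizes G T) \<in> mult less_than" "width G T' \<le> width G T"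
proof -
  let ?N = "nodes T" and ?E = "edges G"
  have tree: "is_tree T" and lv: "Inl ` ?E \<subseteq> leaves T" using T by (auto simp: tree_decomposition_def)
  have sub: "Inl ` ?E \<subseteq> ?N" using lv by (auto simp: leaves_def)
  have nt: "Inl e \<noteq> t" if "e \<in> ?E" for e
    using bad node_bag_leaf[OF G T that] theta_connected_ends[OF G that] by metis
  obtain p where R: "rooted ?N t p" and Tp: "T = rooted_graph ?N t p"
    using tree_rooted_at[OF tree t] .
  interpret rooted ?N t p by fact
  \<comment> \<open>If the leaf were the parent of \<open>x\<close>, its single link would also be
    the link to its own parent, so the two nodes would be parents of each other, against
    depth.\<close>
  have no_child: "p x \<noteq> Inl e" if e: "e \<in> ?E" and x: "x \<in> ?N" for e x
  proof
    assume px: "p x = Inl e"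
    let ?l = "Inl e"
    have le: "?l \<in> ?N" "?l \<noteq> t" using sub nt e by auto
    have xt: "x \<noteq> t" using px le(2) by auto
    have lk: "links T = rooted_links ?N t p" by (subst Tp) simp
    have "card {l \<in> links T. ?l \<in> l} = 1" using lv e by (auto simp: leaves_def)
    then obtain l where l: "{l \<in> links T. ?l \<in> l} = {l}" by (auto simp: card_1_singleton_iff)
    have "{x, p x} \<in> {l \<in> links T. ?l \<in> l}" "{?l, p ?l} \<in> {l \<in> links T. ?l \<in> l}"
      using x xt le px by (auto simp: lk rooted_links_def)
    then have "{x, ?l} = {?l, p ?l}" unfolding l using px by auto
    then have pl: "p ?l = x" using parent_neq[OF x xt] px by (auto simp: doubleton_eq_iff)
    show False using depth_parent[OF x xt, unfolded px] depth_parent[OF le, unfolded pl] by linarith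
  qed
  interpret rooted_decomposition ?N t p G Inl
    by unfold_locales (use G sub nt no_child in auto)
  have nb: "node_bag G T s = bag s" for s
    using node_bag_rooted_graph[OF R G sub, of s] by (metis Tp)
  have U: "bag t \<subseteq> verts G" using rbag_subset_inc inc_subset_verts[OF G order_refl] by (rule subset_trans)
  obtain G1 G2 where sep: "separation G G1 G2" and k: "sep_order G1 G2 < \<theta>"
    "sep_order G1 G2 < card (bag t \<inter> verts G1)" "sep_order G1 G2 < card (bag t \<inter> verts G2)"
    using bad U unfolding nb theta_connected_def by (auto simp: not_le)
  \<comment> \<open>One vertex more than the order of the separation on each side makes the cut set
    of \<open>edges G1\<close> smaller than both \<open>Z1\<close> and \<open>Z2\<close>.\<close>
  obtain Z1 where Z1: "Z1 \<subseteq> bag t \<inter> verts G1" "card Z1 = Suc (sep_order G1 G2)"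
    using obtain_subset_with_card_n[OF Suc_leI[OF k(2)]] by metis
  obtain Z2 where Z2: "Z2 \<subseteq> bag t \<inter> verts G2" "card Z2 = Suc (sep_order G1 G2)"
    using obtain_subset_with_card_n[OF Suc_leI[OF k(3)]] by metis
  \<comment> \<open>Edges outside \<open>edges G1\<close> belong to \<open>G2\<close>, so the cut
    set stays within the common vertices of the separation.\<close>
  have "inc G (edges G1) \<subseteq> verts G1" "inc G (?E - edges G1) \<subseteq> verts G2"
    using sep unfolding separation_def subgraph_of_def fin_mgraph_def inc_def by fastforce+
  then have "cut_set G Z1 Z2 (edges G1) \<subseteq> verts G1 \<inter> verts G2" using Z1 Z2 by (auto simp: cut_set_def)
  moreover have "finite (verts G1 \<inter> verts G2)"
    using sep by (auto simp: separation_def subgraph_of_def fin_mgraph_def)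
  ultimately have c: "card (cut_set G Z1 Z2 (edges G1)) \<le> sep_order G1 G2"
    unfolding sep_order_def by (rule card_mono[rotated])
  have A0: "edges G1 \<subseteq> ?E" using sep by (auto simp: separation_def)
  have adh': "card (bd G (D c)) < \<theta>" if "c \<in> ?N - {t}" for c
    using adh that adhesion_rooted_graph[OF R G sub, of \<theta>] Tp by metis
  obtain T' where T': "tree_decomposition G T'" "adhesion G T' < \<theta>"
    and less: "(bag_sizes G T', image_mset (\<lambda>s. card (bag s)) (mset_set ?N)) \<in> mult less_than"
    and dom: "\<And>t'. t' \<in> nodes T' \<Longrightarrow> \<exists>s\<in>?N. card (node_bag G T' t') \<le> card (bag s)"
    by (rule exists_better_decomposition[of Z1 Z2 "edges G1" \<theta>]) (use Z1 Z2 A0 c k(1) adh' in auto)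
  have "bag_sizes G T = image_mset (\<lambda>s. card (bag s)) (mset_set ?N)"
    unfolding bag_sizes_def nb ..
  moreover have "width G T' \<le> width G T"
  proof -
    have fT': "finite (nodes T')" "nodes T' \<noteq> {}"
      using T'(1) by (auto simp: tree_decomposition_def is_tree_def fin_sgraph_def)
    have "Max ((\<lambda>t. card (node_bag G T' t)) ` nodes T') \<le> Max ((\<lambda>t. card (node_bag G T t)) ` ?N)"
    proof (rule Max.boundedI)
      fix n assume "n \<in> (\<lambda>t. card (node_bag G T' t)) ` nodes T'"
      then obtain s where "s \<in> ?N" "n \<le> card (node_bag G T s)" using dom nb by fastforce
      then show "n \<le> Max ((\<lambda>t. card (node_bag G T t)) ` ?N)"
        using finite_nodes by (meson Max_ge finite_imageI imageI order_trans)
    qed (use fT' in auto)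
    then show ?thesis by (simp add: width_def)
  qed
  ultimately show ?thesis using that T' less by simp
qed

section \<open>Choice of a minimal decomposition\<close>

lemma finite_widths:
  assumes G: "fin_mgraph G"
  shows "finite {width G T | T. tree_decomposition G T \<and> adhesion G T < \<theta>}"
proof (rule finite_subset)
  show "{width G T | T. tree_decomposition G T \<and> adhesion G T < \<theta>} \<subseteq> {-1..int (card (verts G))}"
  proof clarsimp
    fix T assume "tree_decomposition G T"
    then have fT: "finite (nodes T)" "nodes T \<noteq> {}"
      by (auto simp: tree_decomposition_def is_tree_def fin_sgraph_def)
    have "card (node_bag G T t) \<le> card (verts G)" for t
      using G by (intro card_mono) (auto simp: node_bag_def fin_mgraph_def)
    then have "Max ((\<lambda>t. card (node_bag G T t)) ` nodes T) \<le> card (verts G)"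
      using fT by (intro Max.boundedI) auto
    then show "-1 \<le> width G T \<and> width G T \<le> int (card (verts G))" by (auto simp: width_def)
  qed
qed simp

theorem theorem3p1:
  fixes G :: "('v, 'e) mgraph" and \<theta> :: nat
  assumes "fin_mgraph G"
    and "3 \<le> \<theta> \<or> (\<exists>T. tree_decomposition G T \<and> adhesion G T < \<theta>)"
  shows "\<exists>T. tree_decomposition G T \<and> adhesion G T < \<theta> \<and> width G T \<le> tw \<theta> G \<and>
           (\<forall>t\<in>nodes T. theta_connected \<theta> G (node_bag G T t))"
proof -
  let ?W = "{width G T | T. tree_decomposition G T \<and> adhesion G T < \<theta>}"
  \<comment> \<open>The star covers \<theta> \<ge> 3. Together with finiteness of the set of widths,
    this makes \<open>tw\<close> an attained minimum.\<close>
  have "\<exists>T. tree_decomposition G T \<and> adhesion G T < \<theta>"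
    using assms exists_tree_decomposition_adhesion_less_3[OF assms(1)] by (meson less_le_trans)
  then have "?W \<noteq> {}" by blast
  then have "tw \<theta> G \<in> ?W" unfolding tw_def by (rule Min_in[OF finite_widths[OF assms(1)]])
  then obtain T0 where T0: "tree_decomposition G T0" "adhesion G T0 < \<theta>" "width G T0 \<le> tw \<theta> G"
    by auto
  define P where "P T \<longleftrightarrow> tree_decomposition G T \<and> adhesion G T < \<theta> \<and> width G T \<le> tw \<theta> G" for T
  \<comment> \<open>The multiset order on bag sizes is well-founded, so some decomposition
    satisfying \<open>P\<close> is minimal; an improvement at a bad bag would keep \<open>P\<close>
    and be smaller.\<close>
  have "wf (inv_image (mult less_than) (bag_sizes G))" by (intro wf_inv_image wf_mult wf_less_than)
  moreover have "T0 \<in> Collect P" using T0 by (simp add: P_def)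
  ultimately obtain T where T: "P T"
    and least: "\<And>T'. (bag_sizes G T', bag_sizes G T) \<in> mult less_than \<Longrightarrow> \<not> P T'"
    by (rule wfE_min) auto
  have "theta_connected \<theta> G (node_bag G T t)" if t: "t \<in> nodes T" for t
  proof (rule ccontr)
    assume bad: "\<not> ?thesis"
    obtain T' where "tree_decomposition G T'" "adhesion G T' < \<theta>"
      and less: "(bag_sizes G T', bag_sizes G T) \<in> mult less_than" and "width G T' \<le> width G T"
      using improve_decomposition[OF assms(1) _ _ t bad] T unfolding P_def by blast
    then have "P T'" using T unfolding P_def by linarith
    then show False using least[OF less] by blast
  qed
  then show ?thesis using T by (auto simp: P_def)
qed

end
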